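(* Run the clipped stochastic subgradient method (C-SsGM) with parameters $\gamma>0$, $\lambda>0$ and, for every $k\in\mathbb N$, $$\gamma_k=\frac{\gamma}{(k(1+\log k))^{1/p}},\qquad \lambda_k=\max\{L_\varepsilon,\lambda(k(1+\log k))^{1/p}\}.$$ Let $\mathsf x_*\in\operatorname{argmin}_{\mathsf X} f$ and $f_*=\min_{\mathsf X} f$. Set $v_p=4a_p/\lambda^{p-1}$ and $w_p=b_p\max\{L_\varepsilon,\lambda\}^{2-p}$. Then, for every $k\in\mathbb N$, $$\mathbb E[f(x_k)]-f_*\le\frac{(1+\log k)^{1/p}}{k^{(p-1)/p}}\left[\frac59\cdot\frac{\|x_1-\mathsf x_*\|^2}{\gamma}+\frac65\,v_p\|x_1-\mathsf x_*\|+\frac34\,\gamma\big(1+\log(1+\log k)\big)^2\big(v_p+\sqrt{w_p}\big)^2\right].$$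
   Context: Setting. $\mathsf H$ is a real separable Hilbert space; $f:\mathsf H\to\mathbb R$ is convex and Lipschitz continuous with constant $L>0$; $\mathsf X\subset\mathsf H$ is nonempty, closed and convex, with orthogonal projection $P_{\mathsf X}$; $\operatorname{argmin}_{\mathsf X} f\ne\varnothing$. $\xi$ is a random variable and for every $\mathsf x\in\mathsf X$, $\hat u(\mathsf x,\xi)$ is an $\mathsf H$-valued random vector ($\hat u$ jointly measurable) with $\mathbb E\|\hat u(\mathsf x,\xi)\|<\infty$ and $\mathbb E[\hat u(\mathsf x,\xi)]\in\partial f(\mathsf x)$ (convex subdifferential). For some $p\in\,]1,2]$ and $\sigma\ge 0$, $\mathbb E\|\hat u(\mathsf x,\xi)-\mathbb E[\hat u(\mathsf x,\xi)]\|^p\le\sigma^p$ for every $\mathsf x\in\mathsf X$. Constants. Fix a batch size $m\ge1$ and $\varepsilon>0$. Let $\sigma_m\ge0$ be such that for all $\mathsf x\in\mathsf X$, $\mathbb E\|\bar u-\mathbb E\bar u\|^p\le\sigma_m^p$, where $\bar u=\frac1m\sum_{i=1}^m\hat u(\mathsf x,\xi_i)$ with $\xi_1,\dots,\xi_m$ i.i.d. copies of $\xi$. Set $a_p=(1+1/\varepsilon)^{p-1}\sigma_m^p$, $b_p=2^{p-1}(\sigma_m^p+L^p)$, $L_\varepsilon=(1+\varepsilon)L$. Algorithm (C-SsGM). For $\mathsf u\in\mathsf H$ and $\lambda>0$ let $\mathrm{CLIP}(\mathsf u,\lambda)=\max\{\|\mathsf u\|/\lambda,1\}^{-1}\mathsf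 u$. Given stepsizes $\gamma_k>0$, clipping levels $\lambda_k>0$ and a deterministic $x_1\in\mathsf X$, for $k=1,2,\dots$: draw $\boldsymbol\xi^k=(\xi^k_1,\dots,\xi^k_m)$, $m$ independent copies of $\xi$ (the $\boldsymbol\xi^k$ being mutually independent); set $\bar u_k=\frac1m\sum_{j=1}^m\hat u(x_k,\xi^k_j)$, $\tilde u_k=\mathrm{CLIP}(\bar u_k,\lambda_k)$, $x_{k+1}=P_{\mathsf X}(x_k-\gamma_k\tilde u_k)$. *)

theory Defs
  imports "HOL-Probability.Probability"
begin

definition subdifferential :: "('a::real_inner \<Rightarrow> real) \<Rightarrow> 'a \<Rightarrow> 'a set" where
  "subdifferential f x = {u. \<forall>y. f x + u \<bullet> (y - x) \<le> f y}"

(* The library's closest_point requires heine_borel and hence excludes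
   infinite-dimensional Hilbert spaces.  On a nonempty closed convex subset of a
   Hilbert space the nearest point exists and is unique. *)
definition metric_proj :: "'a::metric_space set \<Rightarrow> 'a \<Rightarrow> 'a" where
  "metric_proj X x = (THE y. is_arg_min (dist x) (\<lambda>z. z \<in> X) y)"

definition clip :: "'a::real_normed_vector \<Rightarrow> real \<Rightarrow> 'a" where
  "clip u l = inverse (max (norm u / l) 1) *\<^sub>R u"

(* Measurability of each copy is part of indep_vars. *)
definition iid_copies ::
  "'w measure \<Rightarrow> 's measure \<Rightarrow> ('w \<Rightarrow> 's) \<Rightarrow> nat \<Rightarrow> (nat \<Rightarrow> 'w \<Rightarrow> 's) \<Rightarrow> bool" where
  "iid_copies M S \<xi> m \<eta> \<longleftrightarrow>
     prob_space.indep_vars M (\<lambda>_. S) \<eta> {1..m} \<and>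
     (\<forall>j\<in>{1..m}. distr M S (\<eta> j) = distr M S \<xi>)"

definition batch_mean ::
  "('a::real_vector \<Rightarrow> 's \<Rightarrow> 'a) \<Rightarrow> nat \<Rightarrow> (nat \<Rightarrow> 'w \<Rightarrow> 's) \<Rightarrow> 'a \<Rightarrow> 'w \<Rightarrow> 'a" where
  "batch_mean uhat m \<eta> x \<omega> = (1 / real m) *\<^sub>R (\<Sum>j=1..m. uhat x (\<eta> j \<omega>))"

(* E |Y - E Y|^p <= s^p.  Integrability is explicit because the Bochner integral of a
   non-integrable function is 0. *)
definition central_moment_le ::
  "'w measure \<Rightarrow> real \<Rightarrow> real \<Rightarrow> ('w \<Rightarrow> 'a::{banach, second_countable_topology}) \<Rightarrow> bool" where
  "central_moment_le M p s Y \<longleftrightarrow>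
     integrable M (\<lambda>\<omega>. norm (Y \<omega> - integral\<^sup>L M Y) powr p) \<and>
     (\<integral>\<omega>. norm (Y \<omega> - integral\<^sup>L M Y) powr p \<partial>M) \<le> s powr p"

(* Iterates are indexed from 1; x 0 is unconstrained.  \<zeta> k j is the j-th sample drawn
   at step k, and the last conjunct of the sampling condition makes the whole batches
   \<zeta> k (k >= 1) mutually independent. *)
definition C_SsGM ::
  "'w measure \<Rightarrow> 's measure \<Rightarrow> ('w \<Rightarrow> 's) \<Rightarrow> nat \<Rightarrow>
   ('a::{real_inner, banach, second_countable_topology} \<Rightarrow> 's \<Rightarrow> 'a) \<Rightarrow> 'a set \<Rightarrow>
   (nat \<Rightarrow> real) \<Rightarrow> (nat \<Rightarrow> real) \<Rightarrow> 'a \<Rightarrow> (nat \<Rightarrow> nat \<Rightarrow> 'w \<Rightarrow> 's) \<Rightarrow> (nat \<Rightarrow> 'w \<Rightarrow> 'a) \<Rightarrow> bool" where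
  "C_SsGM M S \<xi> m uhat X step level x1 \<zeta> x \<longleftrightarrow>
     ((\<forall>k\<ge>1. iid_copies M S \<xi> m (\<zeta> k)) \<and>
      prob_space.indep_vars M (\<lambda>_. PiM {1..m} (\<lambda>_. S))
        (\<lambda>k \<omega>. \<lambda>j\<in>{1..m}. \<zeta> k j \<omega>) {1..}) \<and>
     (\<forall>\<omega>\<in>space M. x 1 \<omega> = x1) \<and>
     (\<forall>k\<ge>1. \<forall>\<omega>\<in>space M. x (Suc k) \<omega> =
        metric_proj X (x k \<omega> -
          step k *\<^sub>R clip (batch_mean uhat m (\<zeta> k) (x k \<omega>) \<omega>) (level k)))"

end

theory Submission
  imports Defs
begin

text \<open>
  Conditionally on the past, clipping at level \<open>\<lambda>\<close> biases the subgradient by at most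
  \<open>a\<^sub>p / \<lambda>\<^sup>p\<^sup>-\<^sup>1\<close> and leaves a second moment of at most \<open>b\<^sub>p \<lambda>\<^sup>2\<^sup>-\<^sup>p\<close>; with the given
  parameters the bias times the stepsize and the second moment times its square are both
  \<open>O(s\<^sub>k)\<close> with \<open>s\<^sub>k = 1 / (k (1 + log k))\<close>, whose partial sums grow like \<open>log log\<close>.
  To reach the last iterate \<open>x\<^sub>T\<close> itself, the distance of \<open>x\<^sub>k\<close> is measured not to the minimiser but
  to a running convex combination \<open>z\<^sub>k\<^sub>-\<^sub>1\<close> of the minimiser and the earlier iterates, with weights
  given by the tails \<open>\<gamma>\<^sub>k + \<dots> + \<gamma>\<^sub>T\<close>, for which the function values of all iterates but the last cancel.
  The price is a weight \<open>T / (T - k)\<close> on the \<open>k\<close>-th error term, and the sum of \<open>s\<^sub>k T / (T - k)\<close> is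
  still \<open>O(log log T)\<close> because of the factor \<open>1 + log k\<close> in \<open>s\<^sub>k\<close>.
\<close>

subsection \<open>Metric projection in a Hilbert space\<close>

text \<open>The sets \<open>C n\<close> of points of \<open>X\<close> within
  \<open>d + 1 / (n + 1)\<close> of \<open>x\<close> are closed, nonempty and nested. The
  parallelogram identity forces their diameters to 0, so completeness yields a common point, and
  this point attains the distance.\<close>

lemma closest_point_exists_Hilbert:
  fixes X :: "'a::{real_inner, banach} set"
  assumes X: "X \<noteq> {}" "closed X" "convex X"
  obtains y where "y \<in> X" "\<forall>z\<in>X. dist x y \<le> dist x z"
proof -
  define d where "d = infdist x X"
  define C where "C n = X \<inter> cball x (d + 1 / real (Suc n))" for n
  have d0: "0 \<le> d"
    by (simp add: d_def infdist_nonneg)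
  have d_le: "d \<le> dist x z" if "z \<in> X" for z
    using infdist_le[OF that] by (simp add: d_def)
  have close: "(dist y z)\<^sup>2 \<le> (8 * d + 4) / real (Suc n)" if "y \<in> C n" "z \<in> C n" for y z n
  proof -
    define r where "r = 1 / real (Suc n)"
    have r: "0 < r" "r \<le> 1"
      by (auto simp: r_def)
    have yz: "y \<in> X" "z \<in> X" "norm (x - y) \<le> d + r" "norm (x - z) \<le> d + r"
      using that by (auto simp: C_def r_def dist_norm)
    have "(1/2) *\<^sub>R y + (1/2) *\<^sub>R z \<in> X"
      using convexD[OF X(3) yz(1,2), of "1/2" "1/2"] by simp
    then have "d \<le> norm (x - ((1/2) *\<^sub>R y + (1/2) *\<^sub>R z))"
      using d_le by (simp add: dist_norm)
    then have mid: "d\<^sup>2 \<le> (norm (x - ((1/2) *\<^sub>R y + (1/2) *\<^sub>R z)))\<^sup>2"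
      using d0 by (intro power_mono)
    \<comment> \<open>Parallelogram identity for \<open>x - y\<close> and \<open>x - z\<close>. The
      midpoint of \<open>y\<close> and \<open>z\<close> stays in the convex set, so it is no closer
      to \<open>x\<close> than \<open>d\<close>.\<close>
    have "(norm (y - z))\<^sup>2 = 2 * (norm (x - y))\<^sup>2 + 2 * (norm (x - z))\<^sup>2
        - 4 * (norm (x - ((1/2) *\<^sub>R y + (1/2) *\<^sub>R z)))\<^sup>2"
      unfolding power2_norm_eq_inner by (simp add: algebra_simps inner_commute)
    also have "\<dots> \<le> 2 * (d + r)\<^sup>2 + 2 * (d + r)\<^sup>2 - 4 * d\<^sup>2"
      using mid yz by (intro diff_mono add_mono mult_left_mono power_mono[OF yz(3)] power_mono[OF yz(4)]) auto
    also have "\<dots> = 8 * d * r + 4 * r * r"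
      by (simp add: power2_eq_square algebra_simps)
    also have "\<dots> \<le> 8 * d * r + 4 * r * 1"
      using r by (intro add_left_mono mult_left_mono) auto
    also have "\<dots> = (8 * d + 4) * r"
      by (simp add: algebra_simps)
    finally show ?thesis
      by (simp add: dist_norm r_def)
  qed
  have "\<exists>a. \<forall>n. a \<in> C n"
  proof (rule decreasing_closed_nest[of C])
    show "closed (C n)" for n
      unfolding C_def using X(2) by (intro closed_Int) auto
    show "C n \<noteq> {}" for n
    proof -
      have "\<exists>z\<in>X. dist x z < d + 1 / real (Suc n)"
      proof (rule ccontr)
        assume "\<not> ?thesis"
        then have "d + 1 / real (Suc n) \<le> (INF z\<in>X. dist x z)"
          using X(1) by (intro cINF_greatest) (auto simp: not_less)
        then show False
          using X(1) by (simp add: d_def infdist_def)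
      qed
      then show ?thesis
        by (auto simp: C_def dest: less_imp_le)
    qed
    show "C n \<subseteq> C m" if "m \<le> n" for m n
    proof -
      have "1 / real (Suc n) \<le> 1 / real (Suc m)"
        using that by (intro divide_left_mono) auto
      then show ?thesis
        by (auto simp: C_def)
    qed
    show "\<exists>n. \<forall>x\<in>C n. \<forall>y\<in>C n. dist x y < e" if "e > 0" for e
    proof -
      have "(\<lambda>n. (8 * d + 4) / real (Suc n)) \<longlonglongrightarrow> 0"
        by (rule LIMSEQ_Suc[OF lim_const_over_n])
      then have "eventually (\<lambda>n. (8 * d + 4) / real (Suc n) < e\<^sup>2) sequentially"
        using that by (intro order_tendstoD) auto
      then obtain n where n: "(8 * d + 4) / real (Suc n) < e\<^sup>2"
        by (auto simp: eventually_sequentially)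
      have "dist y z < e" if "y \<in> C n" "z \<in> C n" for y z
        using close[OF that] n \<open>e > 0\<close> by (intro power2_less_imp_less[of _ e]) auto
      then show ?thesis by blast
    qed
  qed blast
  then obtain a where a: "\<And>n. a \<in> C n"
    by blast
  have "dist x a \<le> d"
  proof (rule field_le_epsilon)
    fix e :: real assume "e > 0"
    then obtain n where "inverse (real (Suc n)) < e"
      using reals_Archimedean by blast
    then show "dist x a \<le> d + e"
      using a[of n] by (auto simp: C_def inverse_eq_divide)
  qed
  then show thesis
    using that[of a] a[of 0] d_le by (force simp: C_def)
qed

lemma metric_proj_closest:
  fixes X :: "'a::{real_inner, banach} set"
  assumes X: "X \<noteq> {}" "closed X" "convex X"
  shows "metric_proj X x \<in> X" "\<forall>z\<in>X. dist x (metric_proj X x) \<le> dist x z"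
proof -
  obtain y where y: "y \<in> X" "\<forall>z\<in>X. dist x y \<le> dist x z"
    using closest_point_exists_Hilbert[OF X] by blast
  have "is_arg_min (dist x) (\<lambda>z. z \<in> X) (metric_proj X x)"
    unfolding metric_proj_def
  proof (rule theI[of _ y])
    show "is_arg_min (dist x) (\<lambda>z. z \<in> X) y"
      using y by (auto simp: is_arg_min_def not_less)
    show "y' = y" if "is_arg_min (dist x) (\<lambda>z. z \<in> X) y'" for y'
      using that y X(2,3) by (intro any_closest_point_unique[of X]) (auto simp: is_arg_min_def not_less)
  qed
  then show "metric_proj X x \<in> X" "\<forall>z\<in>X. dist x (metric_proj X x) \<le> dist x z"
    by (auto simp: is_arg_min_def not_less)
qed

lemma metric_proj_dot:
  fixes X :: "'a::{real_inner, banach} set"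
  assumes X: "X \<noteq> {}" "closed X" "convex X" and z: "z \<in> X"
  shows "inner (x - metric_proj X x) (z - metric_proj X x) \<le> 0"
  using any_closest_point_dot[OF X(3,2) metric_proj_closest(1)[OF X] z metric_proj_closest(2)[OF X]] .

text \<open>The variational inequalities at the two projections add up to firm nonexpansiveness;
  Cauchy-Schwarz then leaves one factor to cancel.\<close>

lemma metric_proj_nonexpansive:
  fixes X :: "'a::{real_inner, banach} set"
  assumes X: "X \<noteq> {}" "closed X" "convex X"
  shows "dist (metric_proj X x) (metric_proj X y) \<le> dist x y"
proof -
  let ?a = "metric_proj X x" and ?b = "metric_proj X y"
  have "inner (x - ?a) (?b - ?a) \<le> 0" "inner (y - ?b) (?a - ?b) \<le> 0"
    using metric_proj_dot[OF X] metric_proj_closest(1)[OF X] by auto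
  then have "(norm (?a - ?b))\<^sup>2 \<le> inner (x - y) (?a - ?b)"
    unfolding power2_norm_eq_inner by (simp add: algebra_simps inner_commute)
  also have "\<dots> \<le> norm (x - y) * norm (?a - ?b)"
    by (rule norm_cauchy_schwarz)
  finally show ?thesis
    unfolding dist_norm power2_eq_square
    by (metis mult_right_le_imp_le norm_ge_zero order_le_less)
qed

lemma metric_proj_self:
  fixes X :: "'a::{real_inner, banach} set"
  assumes "closed X" "convex X" "z \<in> X"
  shows "metric_proj X z = z"
  using metric_proj_closest(2)[of X z] assms by fastforce

lemma continuous_on_metric_proj:
  fixes X :: "'a::{real_inner, banach} set"
  assumes X: "X \<noteq> {}" "closed X" "convex X"
  shows "continuous_on A (metric_proj X)"
  by (rule continuous_on_subset[OF lipschitz_on_continuous_on[of 1 UNIV]])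
    (auto intro!: lipschitz_onI metric_proj_nonexpansive X)

subsection \<open>Clipping\<close>

lemma norm_clip_le: "l > 0 \<Longrightarrow> norm (clip u l) \<le> l"
  by (auto simp: clip_def max_def field_simps)

lemma continuous_on_clip: "l > 0 \<Longrightarrow> continuous_on A (\<lambda>u. clip u l)"
  unfolding clip_def by (intro continuous_intros) (auto simp: max_def)

lemma norm_clip_diff:
  assumes "l > 0"
  shows "norm (clip u l - u) = max 0 (norm u - l)"
proof (cases "norm u \<le> l")
  case True
  then show ?thesis using assms by (simp add: clip_def max_def)
next
  case False
  then have n: "norm u > l" "u \<noteq> 0" using assms by auto
  have "clip u l - u = (l / norm u - 1) *\<^sub>R u"
    using n assms by (auto simp: clip_def max_def algebra_simps)
  then have "norm (clip u l - u) = \<bar>l / norm u - 1\<bar> * norm u"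
    by simp
  also have "\<dots> = norm u - l"
    using n assms by (auto simp: abs_if field_simps)
  finally show ?thesis using n by simp
qed

text \<open>Pathwise source of the bias constant. A vector is moved only if its norm exceeds
  \<open>l\<close>, and since \<open>L\<close> is at most \<open>l / (1 + \<epsilon>)\<close>, its
  distance \<open>t\<close> from \<open>v\<close> is then at least a fixed fraction of
  \<open>l\<close>. Writing \<open>t\<close> as \<open>t powr p * t powr (1 - p)\<close> trades this
  lower bound for a negative power of \<open>l\<close>.\<close>

lemma norm_clip_diff_le_powr:
  fixes u v :: "'a::real_normed_vector"
  assumes v: "norm v \<le> L" and L: "L > 0" and e: "\<epsilon> > 0" and l: "(1 + \<epsilon>) * L \<le> l" and p: "1 < p"
  shows "norm (clip u l - u) \<le> (1 + 1/\<epsilon>) powr (p - 1) / l powr (p - 1) * norm (u - v) powr p"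
proof -
  have "0 < (1 + \<epsilon>) * L" using L e by simp
  then have l0: "l > 0" using l by linarith
  show ?thesis
  proof (cases "norm u \<le> l")
    case True
    then show ?thesis
      using l0 by (simp add: norm_clip_diff)
  next
    case False
    define t where "t = norm (u - v)"
    have u_t: "norm u \<le> t + L"
      using norm_triangle_ineq2[of u v] v by (simp add: t_def)
    have "L \<le> l / (1 + \<epsilon>)" using l e by (simp add: field_simps)
    then have "l - l / (1 + \<epsilon>) \<le> t" using False u_t by linarith
    then have l_t: "l \<le> (1 + 1/\<epsilon>) * t" using e by (simp add: field_simps)
    have Ll: "L \<le> l" using l L e by (smt (verit) mult_less_cancel_right2)
    have t0: "t > 0" using u_t False Ll by linarith
    have "norm (clip u l - u) \<le> t"
      using False u_t Ll l0 by (simp add: norm_clip_diff)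
    also have "t = t powr p * t powr (1 - p)"
      using t0 by (simp flip: powr_add)
    also have "\<dots> \<le> t powr p * ((1 + 1/\<epsilon>) / l) powr (p - 1)"
    proof (rule mult_left_mono)
      have "t powr (1 - p) = (1 / t) powr (p - 1)"
        using t0 by (simp add: powr_divide powr_minus_divide[of t "p - 1", simplified])
      also have "\<dots> \<le> ((1 + 1/\<epsilon>) / l) powr (p - 1)"
      proof (rule powr_mono2)
        show "1 / t \<le> (1 + 1/\<epsilon>) / l"
          using l_t t0 l0 by (simp add: field_simps)
      qed (use p t0 in auto)
      finally show "t powr (1 - p) \<le> ((1 + 1/\<epsilon>) / l) powr (p - 1)" .
    qed auto
    also have "((1 + 1/\<epsilon>) / l) powr (p - 1) = (1 + 1/\<epsilon>) powr (p - 1) / l powr (p - 1)"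
      by (rule powr_divide)
    finally show ?thesis
      by (simp add: t_def mult.commute)
  qed
qed

text \<open>Midpoint convexity of the power function, rescaled. If one argument vanishes,
  \<open>1 \<le> 2 powr (p - 1)\<close> is enough.\<close>

lemma powr_add_le:
  fixes a b :: real
  assumes "a \<ge> 0" "b \<ge> 0" "p \<ge> 1"
  shows "(a + b) powr p \<le> 2 powr (p - 1) * (a powr p + b powr p)"
proof -
  have one: "1 \<le> 2 powr (p - 1)" using assms by (intro ge_one_powr_ge_zero) auto
  show ?thesis
  proof (cases "a = 0 \<or> b = 0")
    case True
    then show ?thesis
      using one assms mult_right_mono[OF one, of "a powr p + b powr p"] by auto
  next
    case False
    then have ab: "a > 0" "b > 0" using assms by auto
    have "((1 - 1/2) *\<^sub>R a + (1/2) *\<^sub>R b) powr p \<le> (1 - 1/2) * a powr p + (1/2) * b powr p"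
      by (rule convex_onD[OF powr_convex]) (use ab assms in auto)
    then have "((a + b) / 2) powr p \<le> (a powr p + b powr p) / 2"
      by (simp add: add_divide_distrib)
    then have "(a + b) powr p \<le> 2 powr p * ((a powr p + b powr p) / 2)"
      using ab by (simp add: powr_divide field_simps)
    also have "2 powr p = 2 * 2 powr (p - 1)"
      by (simp add: powr_diff)
    finally show ?thesis by simp
  qed
qed

text \<open>The square is split into exponents \<open>2 - p\<close> and \<open>p\<close>: the first
  factor is bounded by the clipping level, the second by the unclipped norm. Thus a finite second
  moment follows from a \<open>p\<close>-th moment alone, at the price of a power of
  \<open>l\<close>.\<close>

lemma norm_clip_sq_le_powr:
  fixes u v :: "'a::real_normed_vector"
  assumes v: "norm v \<le> L" and l: "l > 0" and p: "1 < p" "p \<le> 2"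
  shows "(norm (clip u l))\<^sup>2 \<le> l powr (2 - p) * (2 powr (p - 1) * (norm (u - v) powr p + L powr p))"
proof (cases "u = 0")
  case True
  then show ?thesis by (simp add: clip_def)
next
  case False
  have c: "norm (clip u l) \<le> norm u" "0 < norm (clip u l)"
    using l False by (auto simp: clip_def max_def field_simps)
  have "(norm (clip u l))\<^sup>2 = norm (clip u l) powr (2 - p) * norm (clip u l) powr p"
    using c by (simp flip: powr_add)
  also have "\<dots> \<le> l powr (2 - p) * norm u powr p"
    using c norm_clip_le[OF l, of u] p by (intro mult_mono powr_mono2) auto
  also have "norm u powr p \<le> (norm (u - v) + L) powr p"
    using norm_triangle_ineq2[of u v] v p by (intro powr_mono2) auto
  also have "\<dots> \<le> 2 powr (p - 1) * (norm (u - v) powr p + L powr p)"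
    using v p order_trans[OF norm_ge_zero v] by (intro powr_add_le) auto
  finally show ?thesis
    by (simp add: mult_left_mono)
qed

section \<open>Subgradients and one clipped projected step in expectation\<close>

lemma subdifferential_norm_le:
  fixes f :: "'a::real_inner \<Rightarrow> real"
  assumes "L-lipschitz_on UNIV f" "u \<in> subdifferential f y"
  shows "norm u \<le> L"
proof -
  \<comment> \<open>Testing the subgradient at \<open>y + u\<close> bounds its squared norm by an
    increment of \<open>f\<close>.\<close>
  have "f y + u \<bullet> (y + u - y) \<le> f (y + u)"
    using assms(2) unfolding subdifferential_def by blast
  moreover have "\<bar>f (y + u) - f y\<bar> \<le> L * norm u"
    using lipschitz_onD[OF assms(1), of "y + u" y] by (simp add: dist_norm)
  ultimately have "norm u * norm u \<le> L * norm u"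
    by (simp add: norm_eq_sqrt_inner)
  then show ?thesis
    using lipschitz_on_nonneg[OF assms(1)] by (cases "u = 0") auto
qed

text \<open>Nonexpansiveness removes the projection and the square is expanded. The mean of the
  clipped vector is a true subgradient plus a bias: the subgradient produces the gap in
  \<open>f\<close>, the bias is paired with \<open>y - z\<close> by Cauchy-Schwarz, and the
  quadratic term is the second moment. Here \<open>y\<close> and \<open>z\<close> are
  deterministic.\<close>

lemma (in prob_space) clipped_step_expectation:
  fixes f :: "'h::{real_inner, banach, second_countable_topology} \<Rightarrow> real"
  assumes lip: "L-lipschitz_on UNIV f" and L: "L > 0"
    and X: "X \<noteq> {}" "closed X" "convex X" and z: "z \<in> X"
    and U: "integrable M U" and sub: "expectation U \<in> subdifferential f y"
    and mom: "central_moment_le M p s U"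
    and p: "1 < p" "p \<le> 2" and e: "\<epsilon> > 0" and l: "(1 + \<epsilon>) * L \<le> l" and g: "g > 0"
  shows "expectation (\<lambda>\<omega>. (norm (metric_proj X (y - g *\<^sub>R clip (U \<omega>) l) - z))\<^sup>2) \<le>
    (norm (y - z))\<^sup>2 - 2 * g * (f y - f z)
     + 2 * g * ((1 + 1/\<epsilon>) powr (p - 1) * s powr p / l powr (p - 1)) * norm (y - z)
     + g\<^sup>2 * (l powr (2 - p) * (2 powr (p - 1) * (s powr p + L powr p)))"
proof -
  define u where "u = expectation U"
  define q where "q = (\<lambda>\<omega>. norm (U \<omega> - u) powr p)"
  define C where "C \<omega> = clip (U \<omega>) l" for \<omega>
  have u: "norm u \<le> L"
    using subdifferential_norm_le[OF lip sub] by (simp add: u_def)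
  have "0 < (1 + \<epsilon>) * L" using L e by simp
  then have l0: "l > 0" using l by linarith
  have [measurable]: "U \<in> borel_measurable M"
    using U by simp
  have C_meas[measurable]: "C \<in> borel_measurable M"
    unfolding C_def
    by (rule borel_measurable_continuous_on[OF continuous_on_clip[OF l0]]) simp
  have C_bound: "norm (C \<omega>) \<le> l" for \<omega>
    using norm_clip_le[OF l0] by (simp add: C_def)
  have C_int: "integrable M C"
    using C_bound by (intro integrable_const_bound[of _ l]) auto
  have q_int: "integrable M q" and q_le: "expectation q \<le> s powr p"
    using mom by (auto simp: central_moment_le_def q_def u_def)
  let ?A = "(1 + 1/\<epsilon>) powr (p - 1) / l powr (p - 1)"
  have bias: "norm (expectation C - u) \<le> ?A * s powr p"
  proof -
    have "expectation C - u = expectation (\<lambda>\<omega>. C \<omega> - U \<omega>)"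
      unfolding u_def using C_int U by simp
    also have "norm \<dots> \<le> expectation (\<lambda>\<omega>. norm (C \<omega> - U \<omega>))"
      by (rule integral_norm_bound)
    also have "\<dots> \<le> expectation (\<lambda>\<omega>. ?A * q \<omega>)"
    proof (rule integral_mono)
      show "integrable M (\<lambda>\<omega>. norm (C \<omega> - U \<omega>))"
        using C_int U by auto
      show "integrable M (\<lambda>\<omega>. ?A * q \<omega>)"
        using q_int by simp
      show "norm (C \<omega> - U \<omega>) \<le> ?A * q \<omega>" for \<omega>
        using norm_clip_diff_le_powr[OF u L e l p(1)] by (simp add: C_def q_def)
    qed
    also have "\<dots> = ?A * expectation q" by simp
    also have "\<dots> \<le> ?A * s powr p"
      using q_le by (intro mult_left_mono) auto
    finally show ?thesis .
  qed
  let ?B = "l powr (2 - p) * 2 powr (p - 1)"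
  have C2_int: "integrable M (\<lambda>\<omega>. (norm (C \<omega>))\<^sup>2)"
    using C_bound by (intro integrable_const_bound[of _ "l\<^sup>2"]) (auto intro!: power_mono)
  have second: "expectation (\<lambda>\<omega>. (norm (C \<omega>))\<^sup>2) \<le> ?B * (s powr p + L powr p)"
  proof -
    have "expectation (\<lambda>\<omega>. (norm (C \<omega>))\<^sup>2) \<le> expectation (\<lambda>\<omega>. ?B * (q \<omega> + L powr p))"
    proof (rule integral_mono)
      show "integrable M (\<lambda>\<omega>. ?B * (q \<omega> + L powr p))"
        using q_int by simp
      show "(norm (C \<omega>))\<^sup>2 \<le> ?B * (q \<omega> + L powr p)" for \<omega>
        using norm_clip_sq_le_powr[OF u l0 p] by (simp add: C_def q_def mult.assoc)
    qed (fact C2_int)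
    also have "\<dots> = ?B * (expectation q + L powr p)"
      using q_int by (simp add: prob_space)
    also have "\<dots> \<le> ?B * (s powr p + L powr p)"
      using q_le by (intro mult_left_mono) auto
    finally show ?thesis .
  qed
  let ?N = "\<lambda>\<omega>. (norm (y - z))\<^sup>2 - 2 * g * (C \<omega> \<bullet> (y - z)) + g\<^sup>2 * (norm (C \<omega>))\<^sup>2"
  have P_meas: "(\<lambda>\<omega>. metric_proj X (y - g *\<^sub>R C \<omega>)) \<in> borel_measurable M"
    by (rule borel_measurable_continuous_on[OF continuous_on_metric_proj[OF X]]) simp
  have N_int: "integrable M ?N"
    using C_int C2_int
    by (intro Bochner_Integration.integrable_add Bochner_Integration.integrable_diff
        integrable_mult_right integrable_inner_left) auto
  have P_le: "(norm (metric_proj X (y - g *\<^sub>R C \<omega>) - z))\<^sup>2 \<le> ?N \<omega>" for \<omega>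
  proof -
    have "norm (metric_proj X (y - g *\<^sub>R C \<omega>) - z) \<le> norm (y - g *\<^sub>R C \<omega> - z)"
      using metric_proj_nonexpansive[OF X, of "y - g *\<^sub>R C \<omega>" z] metric_proj_self[OF X(2,3) z]
      by (simp add: dist_norm)
    then have "(norm (metric_proj X (y - g *\<^sub>R C \<omega>) - z))\<^sup>2 \<le> (norm (y - g *\<^sub>R C \<omega> - z))\<^sup>2"
      by (intro power_mono) auto
    also have "\<dots> = ?N \<omega>"
      unfolding power2_norm_eq_inner
      by (simp add: inner_diff_left inner_diff_right inner_commute algebra_simps power2_eq_square)
    finally show ?thesis .
  qed
  have "expectation (\<lambda>\<omega>. (norm (metric_proj X (y - g *\<^sub>R C \<omega>) - z))\<^sup>2) \<le> expectation ?N"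
    using P_le P_meas N_int
    by (intro integral_mono Bochner_Integration.integrable_bound[OF N_int])
      (auto intro!: AE_I2 order_trans[OF P_le abs_ge_self])
  also have "\<dots> = (norm (y - z))\<^sup>2 - 2 * g * (expectation C \<bullet> (y - z))
      + g\<^sup>2 * expectation (\<lambda>\<omega>. (norm (C \<omega>))\<^sup>2)"
    using C_int C2_int by (simp add: prob_space)
  also have "\<dots> \<le> (norm (y - z))\<^sup>2 - 2 * g * (f y - f z - ?A * s powr p * norm (y - z))
      + g\<^sup>2 * (?B * (s powr p + L powr p))"
  proof (intro add_mono diff_left_mono mult_left_mono order_refl second)
    have "f y + u \<bullet> (z - y) \<le> f z"
      using sub by (simp add: subdifferential_def u_def)
    moreover have "- ((expectation C - u) \<bullet> (y - z)) \<le> ?A * s powr p * norm (y - z)"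
      using Cauchy_Schwarz_ineq2[of "expectation C - u" "y - z"]
        mult_right_mono[OF bias norm_ge_zero[of "y - z"]] by linarith
    ultimately show "f y - f z - ?A * s powr p * norm (y - z) \<le> expectation C \<bullet> (y - z)"
      by (simp add: inner_diff_left inner_diff_right)
  qed (use g in auto)
  finally show ?thesis
    by (simp add: C_def algebra_simps)
qed

subsection \<open>Sums of iterated-logarithmic type\<close>

lemma one_le_times_one_plus_ln: "k \<ge> 1 \<Longrightarrow> 1 \<le> real k * (1 + ln (real k))"
  using mult_mono[of 1 "real k" 1 "1 + ln (real k)"] by simp

text \<open>A discrete comparison with the derivative of \<open>ln (1 + ln x)\<close>: applying
  \<open>ln t \<le> t - 1\<close> once to \<open>n / (n + 1)\<close> and once to
  \<open>l / l'\<close> makes each term at most a telescoping difference.\<close>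

lemma sum_inverse_n_ln_le:
  assumes "n \<ge> 1"
  shows "(\<Sum>k=1..n. 1 / (real k * (1 + ln (real k)))) \<le> 1 + ln (1 + ln (real n))"
  using assms
proof (induction n rule: nat_induct_at_least)
  case base
  then show ?case by simp
next
  case (Suc n)
  define l l' where "l = 1 + ln (real n)" and "l' = 1 + ln (real (Suc n))"
  have l: "1 \<le> l" "l \<le> l'"
    using Suc.hyps by (auto simp: l_def l'_def)
  have "1 / real (Suc n) = 1 - real n / real (Suc n)"
    by (simp add: field_simps)
  also have "\<dots> \<le> - ln (real n / real (Suc n))"
    using ln_le_minus_one[of "real n / real (Suc n)"] Suc.hyps by simp
  also have "\<dots> = l' - l"
    using Suc.hyps by (simp add: l_def l'_def ln_div)
  finally have "1 / real (Suc n) / l' \<le> (l' - l) / l'"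
    using l by (intro divide_right_mono) auto
  also have "\<dots> = 1 - l / l'"
    using l by (simp add: field_simps)
  also have "\<dots> \<le> - ln (l / l')"
    using ln_le_minus_one[of "l / l'"] l by simp
  also have "\<dots> = ln l' - ln l"
    using l by (simp add: ln_div)
  finally have "1 / (real (Suc n) * l') \<le> ln l' - ln l"
    by simp
  with Suc.IH show ?case
    by (simp add: l_def l'_def)
qed

lemma ln_3_bounds: "1 \<le> ln (3::real)" "ln (3::real) \<le> 3/2"
proof -
  show "1 \<le> ln (3::real)"
    using exp_le by (subst ln_ge_iff) auto
  have "ln (3::real) \<le> ln (2 * 2)"
    by (subst ln_le_cancel_iff) auto
  also have "\<dots> = 2 * ln 2"
    by (subst ln_mult_pos) auto
  finally show "ln (3::real) \<le> 3/2"
    using ln2_le_25_over_36 by simp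
qed

text \<open>In the induction step the right side must grow by \<open>1 / l'\<close>, which reduces
  to \<open>2 * n * (l' - l) \<le> l\<close>. The left side is at most 2, so
  \<open>l \<ge> 2\<close> suffices; this holds from \<open>n = 3\<close> on, and the two smaller
  cases are checked directly.\<close>

lemma sum_inverse_ln_le:
  assumes "n \<ge> 1"
  shows "(\<Sum>k=1..n. 1 / (1 + ln (real k))) \<le> 2 * real n / (1 + ln (real n))"
proof -
  consider "n = 1" | "n = 2" | "n \<ge> 3" using assms by linarith
  then show ?thesis
  proof cases
    case 3
    then show ?thesis
    proof (induction n rule: nat_induct_at_least)
      case base
      have "(\<Sum>k=1..3. 1 / (1 + ln (real k))) = 1 + 1 / (1 + ln 2) + 1 / (1 + ln (3::real))"
        by (simp add: eval_nat_numeral)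
      also have "1 / (1 + ln (2::real)) \<le> 1"
        using ln2_ge_two_thirds by simp
      also have "1 + 1 + 1 / (1 + ln (3::real)) \<le> 6 / (1 + ln 3)"
      proof -
        have "2 \<le> 5 / (1 + ln (3::real))"
          using ln_3_bounds by (subst le_divide_eq) auto
        moreover have "6 / (1 + ln (3::real)) = 1 / (1 + ln 3) + 5 / (1 + ln 3)"
          by (simp flip: add_divide_distrib)
        ultimately show ?thesis by simp
      qed
      finally show ?case by simp
    next
      case (Suc n)
      define l l' where "l = 1 + ln (real n)" and "l' = 1 + ln (real (Suc n))"
      have "ln 3 \<le> ln (real n)" using Suc.hyps by simp
      then have "1 \<le> ln (real n)" using ln_3_bounds by linarith
      then have l: "2 \<le> l" "l \<le> l'"
        using Suc.hyps by (auto simp: l_def l'_def)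
      have "l' - l = ln (real (Suc n) / real n)"
        using Suc.hyps by (simp add: l_def l'_def ln_div)
      also have "\<dots> \<le> real (Suc n) / real n - 1"
        using Suc.hyps by (intro ln_le_minus_one) auto
      also have "\<dots> = 1 / real n"
        using Suc.hyps by (simp add: field_simps)
      finally have "2 * real n * (l' - l) \<le> 2"
        using Suc.hyps by (simp add: field_simps)
      then have "2 * real n * l' \<le> (2 * real n + 1) * l"
        using l by (simp add: algebra_simps)
      then have "2 * real n / l \<le> (2 * real n + 1) / l'"
        using l by (simp add: field_simps)
      moreover have "2 * real (Suc n) / l' = (2 * real n + 1) / l' + 1 / l'"
        by (simp flip: add_divide_distrib)
      ultimately have "2 * real n / l + 1 / l' \<le> 2 * real (Suc n) / l'"
        by simp
      with Suc.IH show ?case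
        by (simp add: l_def l'_def)
    qed
  next
    case 2
    have "1 \<le> 3 / (1 + ln (2::real))"
      using ln2_le_25_over_36 ln2_ge_two_thirds by (subst le_divide_eq) auto
    moreover have "4 / (1 + ln (2::real)) = 1 / (1 + ln 2) + 3 / (1 + ln 2)"
      by (simp flip: add_divide_distrib)
    ultimately have "1 + 1 / (1 + ln 2) \<le> 4 / (1 + ln (2::real))"
      by simp
    with 2 show ?thesis by (simp add: eval_nat_numeral)
  qed auto
qed

lemma sum_inverse_le: "n \<ge> 1 \<Longrightarrow> (\<Sum>k=1..n. 1 / real k) \<le> 1 + ln (real n)"
proof (induction n rule: nat_induct_at_least)
  case (Suc n)
  have "1 / real (Suc n) = 1 - real n / real (Suc n)"
    by (simp add: field_simps)
  also have "\<dots> \<le> - ln (real n / real (Suc n))"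
    using ln_le_minus_one[of "real n / real (Suc n)"] Suc.hyps by simp
  also have "\<dots> = ln (real (Suc n)) - ln (real n)"
    using Suc.hyps by (simp add: ln_div)
  finally show ?case
    using Suc.IH by simp
qed simp

text \<open>The two factors are oppositely ordered, so Chebyshev's sum inequality decouples them.\<close>
lemma sum_inverse_ln_convolution_le:
  "(\<Sum>k=1..<T. 1 / ((1 + ln (real k)) * real (T - k))) \<le> 2"
proof (cases "T \<ge> 2")
  case True
  define n where "n = T - 1"
  have n: "n \<ge> 1" "T = Suc n" using True by (auto simp: n_def)
  \<comment> \<open>Indices are shifted to start at 0; \<open>a\<close> increases and
    \<open>b\<close> decreases on the summation range.\<close>
  define a where "a i = 1 / real (n - i)" for i
  define b where "b i = 1 / (1 + ln (real (Suc i)))" for i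
  have "real n * (\<Sum>k=0..<n. a k * b k) \<le> (\<Sum>k=0..<n. a k) * (\<Sum>k=0..<n. b k)"
    by (rule Chebyshev_sum_upper)
      (auto simp: a_def b_def intro!: divide_left_mono mult_pos_pos add_pos_nonneg)
  also have "(\<Sum>k=0..<n. a k) = (\<Sum>k=1..n. 1 / real k)"
    by (rule sum.reindex_bij_witness[of _ "\<lambda>k. n - k" "\<lambda>k. n - k"]) (auto simp: a_def)
  also have "(\<Sum>k=0..<n. b k) = (\<Sum>k=1..n. 1 / (1 + ln (real k)))"
    by (rule sum.reindex_bij_witness[of _ "\<lambda>k. k - 1" "Suc"]) (auto simp: b_def)
  \<comment> \<open>The logarithm of the harmonic sum cancels the denominator of the second bound,
    so the final constant does not depend on \<open>n\<close>.\<close>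
  also have "(\<Sum>k=1..n. 1 / real k) * (\<Sum>k=1..n. 1 / (1 + ln (real k)))
      \<le> (1 + ln (real n)) * (2 * real n / (1 + ln (real n)))"
    using n by (intro mult_mono sum_inverse_le sum_inverse_ln_le sum_nonneg) (auto intro!: divide_nonneg_nonneg add_nonneg_nonneg)
  also have "\<dots> = real n * 2"
  proof -
    have "1 + ln (real n) > 0" using n by (auto intro!: add_pos_nonneg)
    then show ?thesis by (simp add: field_simps)
  qed
  finally have "(\<Sum>k=0..<n. a k * b k) \<le> 2"
    using n by simp
  also have "(\<Sum>k=0..<n. a k * b k) = (\<Sum>k=1..<T. 1 / ((1 + ln (real k)) * real (T - k)))"
    by (rule sum.reindex_bij_witness[of _ "\<lambda>k. k - 1" "Suc"]) (auto simp: a_def b_def n)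
  finally show ?thesis .
qed auto

text \<open>The partial fraction \<open>T / (k * (T - k)) = 1 / k + 1 / (T - k)\<close> splits the
  sum into the iterated-logarithm sum, at most \<open>Sg\<close>, and the convolution, at most 2.
  The term \<open>k = T\<close>, where \<open>max\<close> replaces a zero denominator, adds at most
  1/2.\<close>

lemma weighted_sum_le:
  assumes T: "T \<ge> 1"
  defines "Sg \<equiv> 1 + ln (1 + ln (real T))"
  defines "B \<equiv> \<Sum>k=1..T. 1 / (real k * (1 + ln (real k))) * (real T / real (max (T - k) 1))"
  shows "B \<le> Sg + 5/2" "B \<le> 3/2 * Sg\<^sup>2"
proof -
  consider "T = 1" | "T = 2" | "T \<ge> 3" using assms by linarith
  then have "B \<le> Sg + 5/2 \<and> B \<le> 3/2 * Sg\<^sup>2"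
  proof cases
    case 1
    then show ?thesis by (simp add: B_def Sg_def)
  next
    case 2
    have "B = 2 + 1 / (1 + ln 2)"
      unfolding B_def 2 using ln2_ge_two_thirds by (simp add: eval_nat_numeral field_simps)
    also have "\<dots> \<le> 2 + 1 / (5/3)"
      using ln2_ge_two_thirds by (intro add_left_mono divide_left_mono) auto
    finally have B: "B \<le> 13/5" by simp
    have "2/5 \<le> - ln (3/5::real)"
      using ln_le_minus_one[of "3/5::real"] by simp
    also have "\<dots> = ln (5/3::real)"
      by (simp add: ln_div)
    also have "\<dots> \<le> ln (1 + ln 2)"
      using ln2_ge_two_thirds by (subst ln_le_cancel_iff) auto
    finally have "7/5 \<le> Sg"
      by (simp add: Sg_def 2)
    then have "(7/5)\<^sup>2 \<le> Sg\<^sup>2"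
      by (intro power_mono) auto
    with B \<open>7/5 \<le> Sg\<close> show ?thesis
      by (simp add: power2_eq_square)
  next
    case 3
    have "ln 3 \<le> ln (real T)" using 3 by simp
    then have l: "2 \<le> 1 + ln (real T)" using ln_3_bounds by simp
    have "2/3 \<le> ln (2::real)" by (rule ln2_ge_two_thirds)
    also have "\<dots> \<le> ln (1 + ln (real T))"
      using l by (subst ln_le_cancel_iff) auto
    finally have Sg: "5/3 \<le> Sg" by (simp add: Sg_def)
    have split: "{1..T} = insert T {1..<T}" using T by auto
    have "B = 1 / (1 + ln (real T)) +
        (\<Sum>k=1..<T. 1 / (real k * (1 + ln (real k))) * (real T / real (max (T - k) 1)))"
      unfolding B_def split using T by simp
    also have "(\<Sum>k=1..<T. 1 / (real k * (1 + ln (real k))) * (real T / real (max (T - k) 1)))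
       = (\<Sum>k=1..<T. 1 / (real k * (1 + ln (real k))) + 1 / ((1 + ln (real k)) * real (T - k)))"
    proof (rule sum.cong)
      fix k assume k: "k \<in> {1..<T}"
      then have "1 + ln (real k) > 0" by (auto intro!: add_pos_nonneg)
      moreover have "max (T - k) 1 = T - k" "real (T - k) = real T - real k" "real T - real k > 0"
        using k by auto
      ultimately show "1 / (real k * (1 + ln (real k))) * (real T / real (max (T - k) 1))
        = 1 / (real k * (1 + ln (real k))) + 1 / ((1 + ln (real k)) * real (T - k))"
        using k by (simp add: divide_simps)
    qed simp
    also have "\<dots> = (\<Sum>k=1..<T. 1 / (real k * (1 + ln (real k))))
       + (\<Sum>k=1..<T. 1 / ((1 + ln (real k)) * real (T - k)))"
      by (rule sum.distrib)
    also have "(\<Sum>k=1..<T. 1 / (real k * (1 + ln (real k)))) \<le> (\<Sum>k=1..T. 1 / (real k * (1 + ln (real k))))"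
      by (rule sum_mono2) (auto intro!: divide_nonneg_nonneg mult_nonneg_nonneg add_nonneg_nonneg)
    also have "\<dots> \<le> Sg"
      using sum_inverse_n_ln_le[OF T] by (simp add: Sg_def)
    also have "(\<Sum>k=1..<T. 1 / ((1 + ln (real k)) * real (T - k))) \<le> 2"
      by (rule sum_inverse_ln_convolution_le)
    also have "1 / (1 + ln (real T)) \<le> 1 / 2"
      using l by (intro divide_left_mono) auto
    finally have B: "B \<le> Sg + 5/2" by simp
    \<comment> \<open>The product equals \<open>3/2 * Sg^2 - Sg - 5/2\<close>, whose positive root
      is 5/3. For \<open>T\<close> equal to 1 or 2, \<open>Sg\<close> lies below this root, hence
      the separate cases above.\<close>
    have "0 \<le> (Sg - 5/3) * (3/2 * Sg + 3/2)"
      using Sg by (intro mult_nonneg_nonneg) auto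
    with B show ?thesis
      by (simp add: power2_eq_square algebra_simps)
  qed
  then show "B \<le> Sg + 5/2" "B \<le> 3/2 * Sg\<^sup>2" by auto
qed

subsection \<open>The last-iterate recursion\<close>

text \<open>The product of \<open>tail_sum g T (k+1)\<close> and \<open>tail_scale g T k\<close> does not depend on \<open>k < T\<close>; hence
  multiplying the \<open>k\<close>-th step by \<open>tail_scale g T k\<close> makes all function values except that of the
  last iterate telescope away.\<close>

definition tail_sum :: "(nat \<Rightarrow> real) \<Rightarrow> nat \<Rightarrow> nat \<Rightarrow> real" where
  "tail_sum g T k = (\<Sum>j=k..T. g j)"

definition tail_ratio :: "(nat \<Rightarrow> real) \<Rightarrow> nat \<Rightarrow> nat \<Rightarrow> real" where
  "tail_ratio g T k = (if k < T then tail_sum g T (Suc k) / tail_sum g T k else 1)"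

definition tail_scale :: "(nat \<Rightarrow> real) \<Rightarrow> nat \<Rightarrow> nat \<Rightarrow> real" where
  "tail_scale g T k = real T * g T / tail_sum g T (min (Suc k) T)"

text \<open>As \<open>g T\<close> is the smallest stepsize, the tail from \<open>k\<close> is at
  least \<open>(T - k + 1) * g T\<close>; this yields the bound \<open>T / (T - k)\<close> on the
  scale. At \<open>k = T\<close> the \<open>min\<close> in \<open>tail_scale\<close> repeats the
  value at \<open>T - 1\<close>, in accordance with \<open>tail_ratio\<close> being 1 there.\<close>

lemma tail_weights:
  fixes g :: "nat \<Rightarrow> real"
  assumes T: "T \<ge> 1" and g: "\<forall>k\<in>{1..T}. g T \<le> g k" and gT: "g T > 0"
  defines "\<Gamma> \<equiv> tail_sum g T" and "\<theta> \<equiv> tail_ratio g T" and "r \<equiv> tail_scale g T"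
  shows "k \<in> {1..T} \<Longrightarrow> 0 < \<Gamma> k"
    and "k \<in> {1..T} \<Longrightarrow> 0 \<le> \<theta> k \<and> \<theta> k \<le> 1"
    and "k \<in> {1..T} \<Longrightarrow> \<theta> k * r k = r (k - 1)"
    and "0 < r k"
    and "k < T \<Longrightarrow> \<Gamma> (Suc k) * r k = real T * g T"
    and "k \<in> {1..<T} \<Longrightarrow> \<Gamma> k = g k + \<Gamma> (Suc k)"
    and "g T * r T = real T * g T"
    and "r 0 \<le> 1"
    and "r k \<le> real T / real (max (T - k) 1)"
    and "k \<in> {1..T} \<Longrightarrow> r (k - 1) \<le> r k"
proof -
  have \<Gamma>_def: "\<Gamma> k = (\<Sum>j=k..T. g j)" for k
    by (simp add: assms tail_sum_def)
  have \<theta>_def: "\<theta> k = (if k < T then \<Gamma> (Suc k) / \<Gamma> k else 1)" for k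
    by (simp add: assms tail_ratio_def)
  have r_def: "r k = real T * g T / \<Gamma> (min (Suc k) T)" for k
    by (simp add: assms tail_scale_def)
  have g0: "0 < g k" if "k \<in> {1..T}" for k
    using bspec[OF g that] gT by simp
  have lower: "real (Suc T - k) * g T \<le> \<Gamma> k" if "k \<in> {1..T}" for k
  proof -
    have "(\<Sum>j=k..T. g T) \<le> \<Gamma> k"
      unfolding \<Gamma>_def using that g by (intro sum_mono) auto
    then show ?thesis by simp
  qed
  show pos: "0 < \<Gamma> k" if "k \<in> {1..T}" for k
    using that unfolding \<Gamma>_def by (intro sum_pos g0) auto
  show rec: "\<Gamma> k = g k + \<Gamma> (Suc k)" if "k \<in> {1..<T}" for k
    using that unfolding \<Gamma>_def by (intro sum.atLeast_Suc_atMost) auto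
  show th: "0 \<le> \<theta> k \<and> \<theta> k \<le> 1" if "k \<in> {1..T}" for k
  proof (cases "k < T")
    case True
    then show ?thesis
      using that pos[of k] pos[of "Suc k"] rec[of k] g0[of k] by (simp add: \<theta>_def)
  qed (auto simp: \<theta>_def)
  show rpos: "0 < r k" for k
    unfolding r_def using T gT pos[of "min (Suc k) T"] by (intro divide_pos_pos mult_pos_pos) auto
  show thr: "\<theta> k * r k = r (k - 1)" if "k \<in> {1..T}" for k
  proof (cases "k < T")
    case True
    then show ?thesis
      using that pos[of k] pos[of "Suc k"] by (simp add: \<theta>_def r_def)
  next
    case False
    then have "k = T" using that by auto
    then show ?thesis using T by (simp add: \<theta>_def r_def)
  qed
  show "\<Gamma> (Suc k) * r k = real T * g T" if "k < T"
    using that pos[of "Suc k"] by (simp add: r_def)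
  show "g T * r T = real T * g T"
    using gT by (simp add: r_def \<Gamma>_def)
  show "r 0 \<le> 1"
    using lower[of 1] pos[of 1] T by (simp add: r_def)
  show "r k \<le> real T / real (max (T - k) 1)" for k
  proof -
    have "real (max (T - k) 1) * g T \<le> \<Gamma> (min (Suc k) T)"
    proof (cases "k < T")
      case True
      then have "max (T - k) 1 = Suc T - Suc k" "min (Suc k) T = Suc k" by auto
      then show ?thesis using lower[of "Suc k"] True by simp
    next
      case False
      then show ?thesis using lower[of T] T by (simp add: max_def min_def)
    qed
    then have "real T * g T / \<Gamma> (min (Suc k) T) \<le> real T * g T / (real (max (T - k) 1) * g T)"
      using gT T by (intro divide_left_mono mult_pos_pos pos) auto
    then show ?thesis
      using gT by (simp add: r_def)
  qed
  show "r (k - 1) \<le> r k" if "k \<in> {1..T}"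
    using th[OF that] thr[OF that] rpos[of k] mult_right_mono[of "\<theta> k" 1 "r k"] by simp
qed

text \<open>\<open>F\<close> and \<open>Z\<close> stand for the gaps at the iterates and at the
  comparison points, \<open>e\<close> for the mean squared distances between them. Scaling by
  \<open>r k\<close> makes the distances telescope because
  \<open>\<theta> k * r k = r (k - 1)\<close>. The function values are absorbed by the potential
  \<open>2 * T * g T * Z K\<close>, carried along in the invariant \<open>inv\<close>.\<close>

lemma last_iterate_recursion:
  fixes g e F Z b h :: "nat \<Rightarrow> real"
  assumes T: "T \<ge> 1" and g: "\<forall>k\<in>{1..T}. g T \<le> g k" and gT: "g T > 0"
  defines "\<Gamma> \<equiv> tail_sum g T" and "\<theta> \<equiv> tail_ratio g T" and "r \<equiv> tail_scale g T"
  assumes F: "\<And>k. F k \<ge> 0" and Z: "\<And>k. Z k \<ge> 0" and Z0: "Z 0 = 0" and e1: "0 \<le> e 1"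
    and step: "\<forall>k\<in>{1..T}.
      e (Suc k) \<le> \<theta> k * e k - 2 * g k * (F k - Z k) + b k * \<theta> k * sqrt (e k) + h k"
    and avg: "\<forall>k\<in>{1..T}. Z k \<le> (1 - \<theta> k) * F k + \<theta> k * Z (k - 1)"
  defines "R \<equiv> \<lambda>K. e 1 + (\<Sum>k=1..K. b k * r (k - 1) * sqrt (e k) + r k * h k)"
  shows "K < T \<Longrightarrow> r K * e (Suc K) \<le> R K" and "2 * (real T * g T) * F T + r T * e (Suc T) \<le> R T"
proof -
  note w = tail_weights[of T g, OF T g gT, folded \<Gamma>_def \<theta>_def r_def]
  have scaled: "r k * e (Suc k) \<le> r (k - 1) * e k - 2 * (g k * r k) * (F k - Z k)
      + (b k * r (k - 1) * sqrt (e k) + r k * h k)" if k: "k \<in> {1..T}" for k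
  proof -
    have "r k * e (Suc k) \<le>
        r k * (\<theta> k * e k - 2 * g k * (F k - Z k) + b k * \<theta> k * sqrt (e k) + h k)"
      using bspec[OF step k] w(4)[of k] by (intro mult_left_mono) auto
    also have "\<dots> = (\<theta> k * r k) * e k - 2 * (g k * r k) * (F k - Z k)
      + (b k * (\<theta> k * r k) * sqrt (e k) + r k * h k)"
      by (simp add: algebra_simps)
    finally show ?thesis using w(3)[OF k] by simp
  qed
  have inv: "r K * e (Suc K) + 2 * (real T * g T) * Z K \<le> R K" if "K < T" for K
    using that
  proof (induction K)
    case 0
    have "r 0 * e 1 \<le> 1 * e 1"
      using w(8) e1 by (intro mult_right_mono)
    then show ?case by (simp add: R_def Z0)
  next
    case (Suc K)
    let ?k = "Suc K"
    have k: "?k \<in> {1..T}" "?k \<in> {1..<T}" "?k < T" using Suc.prems by auto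
    \<comment> \<open>With this identity, \<open>avg\<close> scaled by
      \<open>\<Gamma> k * r k\<close> has exactly the coefficients needed to cancel
      \<open>F k\<close> and to pass from \<open>Z k\<close> to \<open>Z (k - 1)\<close>.\<close>
    have C: "g ?k * r ?k + real T * g T = \<Gamma> ?k * r ?k"
      using w(5)[OF k(3)] w(6)[OF k(2)] by (simp add: algebra_simps)
    have th: "\<theta> ?k * \<Gamma> ?k = \<Gamma> (Suc ?k)"
      using k w(1)[OF k(1)] by (simp add: \<theta>_def tail_ratio_def \<Gamma>_def)
    have "\<Gamma> ?k * r ?k * Z ?k \<le> \<Gamma> ?k * r ?k * ((1 - \<theta> ?k) * F ?k + \<theta> ?k * Z K)"
      using bspec[OF avg k(1)] w(1)[OF k(1)] w(4)[of ?k] by (intro mult_left_mono) auto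
    also have "\<dots> = r ?k * (\<Gamma> ?k - \<theta> ?k * \<Gamma> ?k) * F ?k + r ?k * (\<theta> ?k * \<Gamma> ?k) * Z K"
      by (simp add: algebra_simps)
    also have "\<dots> = g ?k * r ?k * F ?k + real T * g T * Z K"
      unfolding th using w(5)[OF k(3)] w(6)[OF k(2)] by (simp add: algebra_simps)
    finally have "(g ?k * r ?k + real T * g T) * Z ?k \<le> g ?k * r ?k * F ?k + real T * g T * Z K"
      unfolding C .
    then show ?case
      using scaled[OF k(1)] Suc.IH Suc.prems by (simp add: R_def algebra_simps)
  qed
  show "r K * e (Suc K) \<le> R K" if "K < T"
  proof -
    have "0 \<le> 2 * (real T * g T) * Z K"
      using gT Z by (intro mult_nonneg_nonneg) auto
    then show ?thesis using inv[OF that] by linarith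
  qed
  obtain K where K: "T = Suc K" using T by (cases T) auto
  \<comment> \<open>At the last step the ratio is 1, so the comparison point does not move and
    \<open>F T\<close> is not spent on bounding \<open>Z T\<close>; it is the one gap that
    survives.\<close>
  have "Z T \<le> Z K"
    using bspec[OF avg, of T] T K by (simp add: \<theta>_def tail_ratio_def)
  then have "real T * g T * Z T \<le> real T * g T * Z K"
    using gT by (intro mult_left_mono) auto
  moreover have "r T * e (Suc T) \<le> r K * e T - 2 * (real T * g T) * (F T - Z T)
      + (b T * r K * sqrt (e T) + r T * h T)"
    using scaled[of T] T unfolding w(7) by (simp add: K)
  moreover have "R T = R K + (b T * r K * sqrt (e T) + r T * h T)"
    by (simp add: R_def K)
  moreover have "r K * e T + 2 * (real T * g T) * Z K \<le> R K"
    using inv[of K] K by simp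
  ultimately show "2 * (real T * g T) * F T + r T * e (Suc T) \<le> R T"
    by (simp add: algebra_simps)
qed

text \<open>A weakened quadratic formula: the exact root, half of
  \<open>c + sqrt (c^2 + 4 * y^2)\<close>, is at most \<open>c + y\<close>.\<close>

lemma quadratic_root_le:
  fixes x c y :: real
  assumes "x\<^sup>2 \<le> y\<^sup>2 + c * x" "0 \<le> c" "0 \<le> y"
  shows "x \<le> c + y"
proof (rule ccontr)
  assume "\<not> ?thesis"
  then have x: "c + y < x" by simp
  have "y * y \<le> y * x" "0 < x" using x assms by (auto intro!: mult_left_mono)
  moreover have "(c + y) * x < x * x" using x \<open>0 < x\<close> by (intro mult_strict_right_mono)
  ultimately show False
    using assms(1) by (simp add: power2_eq_square algebra_simps)
qed

text \<open>The inequality for \<open>R\<close> contains \<open>sqrt R\<close> on the right. Solving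
  it crudely for \<open>sqrt R\<close> and inserting the result once into the term
  \<open>c * sqrt R\<close> gives an explicit bound; what remains is to absorb \<open>a\<close>,
  \<open>h\<close> and the mixed terms into the stated constants.\<close>

lemma final_constants:
  fixes D g v W S B R :: real
  assumes nn: "0 \<le> D" "0 \<le> g" "0 \<le> v" "0 \<le> W" "0 \<le> B" and S: "1 \<le> S"
    and B: "B \<le> S + 5/2" "B \<le> 3/2 * S\<^sup>2"
    and R: "0 \<le> R" "R \<le> D\<^sup>2 + g\<^sup>2 * W\<^sup>2 * B + g * v / 2 * sqrt (S * B) * sqrt R"
  shows "R / 2 \<le> 5/9 * D\<^sup>2 + 6/5 * (g * v * D) + 3/4 * g\<^sup>2 * S\<^sup>2 * (v + W)\<^sup>2"
proof -
  define h a c where "h = sqrt B" and "a = sqrt (S * B)" and "c = g * v / 2 * a"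
  have h: "0 \<le> h" "h\<^sup>2 = B" and a: "0 \<le> a" "a\<^sup>2 = S * B" and c: "0 \<le> c"
    using nn S by (auto simp: h_def a_def c_def)
  have "S * B \<le> S * (S + 5/2)" using B S by (intro mult_left_mono) auto
  then have SB: "S * B \<le> S\<^sup>2 + 5/2 * S" by (simp add: power2_eq_square algebra_simps)
  have "S \<le> S\<^sup>2" using S by (simp add: power2_eq_square)
  then have a2: "a\<^sup>2 \<le> 7/2 * S\<^sup>2" using SB a by simp
  \<comment> \<open>The square of \<open>S + 5/4\<close> exceeds \<open>S^2 + 5/2 * S\<close> by
    25/16. This linear bound on \<open>a\<close> is sharper in \<open>S\<close> than the root of
    \<open>a2\<close> and is kept for the term with \<open>D\<close>.\<close>
  have "a\<^sup>2 \<le> (S + 5/4)\<^sup>2" using SB a by (simp add: power2_eq_square algebra_simps)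
  then have aS: "a \<le> S + 5/4" by (rule power2_le_imp_le) (use S in simp)
  have ah: "a * h \<le> 5/2 * S\<^sup>2"
    using sum_squares_bound[of a h] a2 h B by simp
  have "(sqrt R)\<^sup>2 \<le> (D + g * W * h)\<^sup>2 + c * sqrt R"
  proof -
    have "0 \<le> D * (g * W * h)" using nn h by simp
    moreover have "(D + g * W * h)\<^sup>2 = D\<^sup>2 + g\<^sup>2 * W\<^sup>2 * B + 2 * (D * (g * W * h))"
      unfolding h(2)[symmetric] by (simp add: power2_eq_square algebra_simps)
    ultimately show ?thesis
      using R by (simp add: c_def a_def)
  qed
  then have "sqrt R \<le> c + (D + g * W * h)"
    by (rule quadratic_root_le) (use nn h c in auto)
  then have "c * sqrt R \<le> c * (c + (D + g * W * h))"
    using c by (intro mult_left_mono)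
  then have "R \<le> D\<^sup>2 + g\<^sup>2 * W\<^sup>2 * B + c * (c + (D + g * W * h))"
    using R(2) unfolding c_def a_def by linarith
  also have "\<dots> = D\<^sup>2 + g\<^sup>2 * W\<^sup>2 * B + (g * v)\<^sup>2 / 4 * a\<^sup>2 + g * v * D / 2 * a + g\<^sup>2 * v * W / 2 * (a * h)"
    by (simp add: c_def power2_eq_square algebra_simps)
  also have "\<dots> \<le> D\<^sup>2 + g\<^sup>2 * W\<^sup>2 * (3/2 * S\<^sup>2) + (g * v)\<^sup>2 / 4 * (7/2 * S\<^sup>2)
      + g * v * D / 2 * (S + 5/4) + g\<^sup>2 * v * W / 2 * (5/2 * S\<^sup>2)"
    using nn B(2) a2 aS ah by (intro add_mono mult_left_mono order_refl) auto
  also have "g * v * D / 2 * (S + 5/4) \<le> D\<^sup>2 / 9 + 9/16 * ((g * v)\<^sup>2 * S\<^sup>2) + 5/8 * (g * v * D)"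
  proof -
    \<comment> \<open>The weights are chosen so that the mixed term becomes
      \<open>g * v * D * S / 2\<close>; the extra \<open>D^2 / 9\<close> is what turns 1/2 into 5/9
      after halving.\<close>
    have "0 \<le> (D / 3 - 3/4 * (g * v * S))\<^sup>2" by simp
    then show ?thesis by (simp add: power2_eq_square algebra_simps)
  qed
  finally have R_le: "R \<le> 10/9 * D\<^sup>2 + 5/8 * (g * v * D) + 3/2 * (g\<^sup>2 * W\<^sup>2 * S\<^sup>2)
      + 23/16 * (g\<^sup>2 * v\<^sup>2 * S\<^sup>2) + 5/4 * (g\<^sup>2 * v * W * S\<^sup>2)"
    by (simp add: power_mult_distrib algebra_simps)
  \<comment> \<open>Treating the monomials as variables leaves a linear comparison: 5/8 against
    12/5, 23/16 against 3/2, and 5/4 against 3.\<close>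
  have arith: "R \<le> 2 * (5/9 * a + 6/5 * b + 3/4 * (d + 2 * e + c))"
    if "0 \<le> b" "0 \<le> d" "0 \<le> e" "R \<le> 10/9 * a + 5/8 * b + 3/2 * c + 23/16 * d + 5/4 * e" for a b c d e :: real
    using that by (simp add: field_simps)
  have "0 \<le> g * v * D" "0 \<le> g\<^sup>2 * v\<^sup>2 * S\<^sup>2" "0 \<le> g\<^sup>2 * v * W * S\<^sup>2"
    using nn by auto
  then have "R \<le> 2 * (5/9 * D\<^sup>2 + 6/5 * (g * v * D) + 3/4 * (g\<^sup>2 * v\<^sup>2 * S\<^sup>2 + 2 * (g\<^sup>2 * v * W * S\<^sup>2) + g\<^sup>2 * W\<^sup>2 * S\<^sup>2))"
    using R_le by (rule arith)
  also have "g\<^sup>2 * v\<^sup>2 * S\<^sup>2 + 2 * (g\<^sup>2 * v * W * S\<^sup>2) + g\<^sup>2 * W\<^sup>2 * S\<^sup>2 = g\<^sup>2 * S\<^sup>2 * (v + W)\<^sup>2"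
    by (simp add: power2_eq_square algebra_simps)
  finally show ?thesis by simp
qed

text \<open>A self-bounding argument. Every partial sum \<open>R K\<close> is at most
  \<open>R T\<close>, so each \<open>r (k - 1) * e k\<close> is too; the square roots in the bias
  terms are thereby controlled by \<open>sqrt (R T)\<close>, which gives the implicit inequality
  solved by \<open>final_constants\<close>.\<close>

lemma last_iterate_bound:
  fixes g e F Z b h s :: "nat \<Rightarrow> real"
  assumes T: "T \<ge> 1" and g: "\<forall>k\<in>{1..T}. g T \<le> g k" and gT: "g T > 0"
  defines "\<theta> \<equiv> tail_ratio g T"
  assumes F: "\<And>k. F k \<ge> 0" and Z: "\<And>k. Z k \<ge> 0" and Z0: "Z 0 = 0"
    and e: "\<And>k. 0 \<le> e k" and e1: "e 1 = D\<^sup>2" and D: "0 \<le> D"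
    and step: "\<forall>k\<in>{1..T}.
      e (Suc k) \<le> \<theta> k * e k - 2 * g k * (F k - Z k) + b k * \<theta> k * sqrt (e k) + h k"
    and avg: "\<forall>k\<in>{1..T}. Z k \<le> (1 - \<theta> k) * F k + \<theta> k * Z (k - 1)"
    and s: "\<And>k. k \<in> {1..T} \<Longrightarrow> 0 \<le> s k" and nn: "0 \<le> \<gamma>" "0 \<le> v" "0 \<le> W"
    and b: "\<And>k. k \<in> {1..T} \<Longrightarrow> 0 \<le> b k \<and> b k \<le> \<gamma> * v / 2 * s k"
    and h: "\<And>k. k \<in> {1..T} \<Longrightarrow> 0 \<le> h k \<and> h k \<le> \<gamma>\<^sup>2 * W\<^sup>2 * s k"
    and S: "1 \<le> S" "(\<Sum>k=1..T. s k) \<le> S"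
    and B: "B = (\<Sum>k=1..T. s k * (real T / real (max (T - k) 1)))" "B \<le> S + 5/2" "B \<le> 3/2 * S\<^sup>2"
  shows "real T * g T * F T \<le> 5/9 * D\<^sup>2 + 6/5 * (\<gamma> * v * D) + 3/4 * \<gamma>\<^sup>2 * S\<^sup>2 * (v + W)\<^sup>2"
proof -
  define \<Gamma> where "\<Gamma> = tail_sum g T"
  define r where "r = tail_scale g T"
  define t where "t k = b k * r (k - 1) * sqrt (e k) + r k * h k" for k
  define R where "R K = e 1 + (\<Sum>k=1..K. t k)" for K
  define q where "q k = real T / real (max (T - k) 1)" for k
  note w = tail_weights[of T g, OF T g gT, folded \<Gamma>_def \<theta>_def r_def]
  note rec = last_iterate_recursion[of T g F Z e b h, OF T g gT F Z Z0 e step[unfolded \<theta>_def] avg[unfolded \<theta>_def],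
      folded r_def, folded t_def, folded R_def]
  have rq: "r k \<le> q k" for k
    using w(9) by (simp add: q_def)
  have t0: "0 \<le> t k" if "k \<in> {1..T}" for k
    unfolding t_def using b[OF that] h[OF that] w(4) e[of k]
    by (intro add_nonneg_nonneg mult_nonneg_nonneg) (auto intro: less_imp_le)
  have R_mono: "R K \<le> R T" if "K \<le> T" for K
    unfolding R_def using that by (intro add_left_mono sum_mono2) (auto intro!: t0)
  have R0: "0 \<le> R T"
    using R_mono[of 0] e[of 1] by (simp add: R_def)
  have re: "r (k - 1) * e k \<le> R T" if k: "k \<in> {1..T}" for k
    using rec(1)[of "k - 1"] R_mono[of "k - 1"] k by (cases k) auto
  have t_le: "t k \<le> \<gamma> * v / 2 * sqrt (R T) * (s k * sqrt (q k)) + \<gamma>\<^sup>2 * W\<^sup>2 * (s k * q k)"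
    if k: "k \<in> {1..T}" for k
  proof -
    \<comment> \<open>One square root of the scale joins \<open>e k\<close>, where \<open>re\<close>
      applies; the other is bounded by \<open>sqrt (q k)\<close>.\<close>
    have "r (k - 1) * sqrt (e k) = sqrt (r (k - 1)) * sqrt (r (k - 1) * e k)"
      using w(4)[of "k - 1"] e[of k] by (simp add: real_sqrt_mult)
    also have "\<dots> \<le> sqrt (q k) * sqrt (R T)"
      using re[OF k] w(10)[OF k] rq[of k] w(4)[of "k - 1"] e[of k]
      by (intro mult_mono) auto
    finally have rs: "r (k - 1) * sqrt (e k) \<le> sqrt (q k) * sqrt (R T)" .
    have "b k * (r (k - 1) * sqrt (e k)) \<le> (\<gamma> * v / 2 * s k) * (sqrt (q k) * sqrt (R T))"
      by (rule mult_mono[OF _ rs]) (use b[OF k] w(4)[of "k - 1"] e[of k] in auto)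
    moreover have "r k * h k \<le> q k * (\<gamma>\<^sup>2 * W\<^sup>2 * s k)"
      using rq[of k] h[OF k] by (intro mult_mono) (auto simp: q_def)
    ultimately show ?thesis
      by (simp add: t_def algebra_simps)
  qed
  have B': "B = (\<Sum>k=1..T. s k * q k)"
    by (simp add: B q_def)
  have q0: "0 \<le> q k" for k by (simp add: q_def)
  have B0: "0 \<le> B"
    unfolding B' by (intro sum_nonneg mult_nonneg_nonneg s q0) auto
  have V: "(\<Sum>k=1..T. s k * sqrt (q k)) \<le> sqrt (S * B)"
  proof (rule real_le_rsqrt)
    \<comment> \<open>Cauchy-Schwarz, splitting \<open>s k\<close> evenly, separates the plain sum
      from the weighted sum \<open>B\<close>.\<close>
    have "(\<Sum>k=1..T. s k * sqrt (q k))\<^sup>2 = (\<Sum>k=1..T. sqrt (s k) * sqrt (s k * q k))\<^sup>2"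
      using s by (intro arg_cong[of _ _ power2] sum.cong) (auto simp: real_sqrt_mult simp flip: mult.assoc)
    also have "\<dots> \<le> (\<Sum>k=1..T. (sqrt (s k))\<^sup>2) * (\<Sum>k=1..T. (sqrt (s k * q k))\<^sup>2)"
      by (rule Cauchy_Schwarz_ineq_sum)
    also have "\<dots> = (\<Sum>k=1..T. s k) * B"
      unfolding B' using s q0 by (intro arg_cong2[of _ _ _ _ times] sum.cong) auto
    also have "\<dots> \<le> S * B"
      using S B0 by (intro mult_right_mono)
    finally show "(\<Sum>k=1..T. s k * sqrt (q k))\<^sup>2 \<le> S * B" .
  qed
  have "R T \<le> D\<^sup>2 + (\<Sum>k=1..T. \<gamma> * v / 2 * sqrt (R T) * (s k * sqrt (q k)) + \<gamma>\<^sup>2 * W\<^sup>2 * (s k * q k))"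
    unfolding R_def[of T] e1[symmetric]
    by (intro add_left_mono sum_mono) (use t_le in \<open>simp add: R_def\<close>)
  also have "\<dots> = D\<^sup>2 + \<gamma>\<^sup>2 * W\<^sup>2 * B + \<gamma> * v / 2 * sqrt (R T) * (\<Sum>k=1..T. s k * sqrt (q k))"
    by (simp add: B' sum.distrib sum_distrib_left)
  also have "\<dots> \<le> D\<^sup>2 + \<gamma>\<^sup>2 * W\<^sup>2 * B + \<gamma> * v / 2 * sqrt (R T) * sqrt (S * B)"
    using V nn R0 by (intro add_left_mono mult_left_mono) auto
  finally have "R T / 2 \<le> 5/9 * D\<^sup>2 + 6/5 * (\<gamma> * v * D) + 3/4 * \<gamma>\<^sup>2 * S\<^sup>2 * (v + W)\<^sup>2"
    by (intro final_constants[where B = B]) (use D nn B0 S B R0 in \<open>auto simp: algebra_simps\<close>)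
  moreover have "2 * (real T * g T * F T) \<le> R T"
  proof -
    have "0 \<le> r T * e (Suc T)" using w(4)[of T] e[of "Suc T"] by simp
    then show ?thesis using rec(2) by simp
  qed
  ultimately show ?thesis by linarith
qed

subsection \<open>The stochastic iteration\<close>

text \<open>Replaces conditional expectation: by independence the joint law is a product, so Fubini
  lets a bound valid for each frozen value \<open>a\<close> be integrated over
  \<open>W\<close>.\<close>

lemma (in prob_space) indep_var_expectation_le:
  fixes \<phi> :: "'b \<Rightarrow> 'b \<Rightarrow> real"
  assumes ind: "indep_var N W K Y"
    and \<phi>: "(\<lambda>(a, b). \<phi> a b) \<in> borel_measurable (N \<Otimes>\<^sub>M K)"
    and bnd: "\<And>a b. a \<in> space N \<Longrightarrow> b \<in> space K \<Longrightarrow> \<bar>\<phi> a b\<bar> \<le> c"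
    and le: "\<And>a. a \<in> space N \<Longrightarrow> expectation (\<lambda>\<omega>. \<phi> a (Y \<omega>)) \<le> \<psi> a"
    and \<psi>: "\<psi> \<in> borel_measurable N" "integrable M (\<lambda>\<omega>. \<psi> (W \<omega>))"
  shows "expectation (\<lambda>\<omega>. \<phi> (W \<omega>) (Y \<omega>)) \<le> expectation (\<lambda>\<omega>. \<psi> (W \<omega>))"
proof -
  have rv: "random_variable N W" "random_variable K Y"
    and eq: "distr M N W \<Otimes>\<^sub>M distr M K Y = distr M (N \<Otimes>\<^sub>M K) (\<lambda>x. (W x, Y x))"
    using ind by (auto simp: indep_var_distribution_eq)
  interpret W: prob_space "distr M N W" using rv by (intro prob_space_distr)
  interpret Y: prob_space "distr M K Y" using rv by (intro prob_space_distr)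
  interpret P: pair_prob_space "distr M N W" "distr M K Y" ..
  have le': "(\<integral>b. \<phi> a b \<partial>distr M K Y) \<le> \<psi> a" if "a \<in> space N" for a
  proof -
    have "\<phi> a \<in> borel_measurable K"
      using measurable_compose[OF measurable_Pair1'[OF that] \<phi>] by simp
    then show ?thesis
      using le[OF that] rv by (subst integral_distr) auto
  qed
  have \<phi>_int: "integrable (distr M N W \<Otimes>\<^sub>M distr M K Y) (\<lambda>(a, b). \<phi> a b)"
    by (rule P.P.integrable_const_bound[of _ c])
      (use \<phi> bnd in \<open>auto simp: space_pair_measure intro!: AE_I2\<close>)
  have "expectation (\<lambda>\<omega>. \<phi> (W \<omega>) (Y \<omega>)) = (\<integral>z. (\<lambda>(a, b). \<phi> a b) z \<partial>distr M (N \<Otimes>\<^sub>M K) (\<lambda>x. (W x, Y x)))"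
    using rv \<phi> by (subst integral_distr) auto
  also have "\<dots> = (\<integral>a. (\<integral>b. \<phi> a b \<partial>distr M K Y) \<partial>distr M N W)"
    unfolding eq[symmetric] using P.integral_fst'[OF \<phi>_int] by simp
  also have "\<dots> \<le> (\<integral>a. \<psi> a \<partial>distr M N W)"
    using P.integrable_fst'[OF \<phi>_int] \<psi> rv le'
    by (intro integral_mono) (auto simp: integrable_distr_eq)
  also have "\<dots> = expectation (\<lambda>\<omega>. \<psi> (W \<omega>))"
    using rv \<psi> by (subst integral_distr) auto
  finally show ?thesis .
qed

text \<open>Nonnegativity of the variance.\<close>

lemma (in prob_space) expectation_le_sqrt:
  fixes Y :: "'a \<Rightarrow> real"
  assumes "integrable M Y" "integrable M (\<lambda>\<omega>. (Y \<omega>)\<^sup>2)"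
  shows "expectation Y \<le> sqrt (expectation (\<lambda>\<omega>. (Y \<omega>)\<^sup>2))"
  using variance_positive[of Y] variance_eq[OF assms] by (intro real_le_rsqrt) simp

text \<open>The law of a batch is determined by that of \<open>\<xi>\<close>, so all batches of the
  run and the reference batch share one law.\<close>

lemma (in prob_space) distr_iid_copies:
  assumes "iid_copies M S \<xi> m \<eta>" "m \<ge> 1"
  shows "distr M (PiM {1..m} (\<lambda>_. S)) (\<lambda>\<omega>. \<lambda>j\<in>{1..m}. \<eta> j \<omega>) = PiM {1..m} (\<lambda>_. distr M S \<xi>)"
proof -
  have ind: "indep_vars (\<lambda>_. S) \<eta> {1..m}" and eq: "\<And>j. j \<in> {1..m} \<Longrightarrow> distr M S (\<eta> j) = distr M S \<xi>"
    using assms by (auto simp: iid_copies_def)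
  have "distr M (PiM {1..m} (\<lambda>_. S)) (\<lambda>\<omega>. \<lambda>j\<in>{1..m}. \<eta> j \<omega>) = PiM {1..m} (\<lambda>j. distr M S (\<eta> j))"
    using ind assms(2) by (subst indep_vars_iff_distr_eq_PiM'[symmetric]) (auto simp: indep_vars_def)
  also have "\<dots> = PiM {1..m} (\<lambda>_. distr M S \<xi>)"
    using eq by (intro PiM_cong) auto
  finally show ?thesis .
qed

text \<open>Indices are shifted by one: \<open>sgm_iter \<Phi> x1 w n\<close> is the iterate \<open>x\<^sub>n\<^sub>+\<^sub>1\<close>, which uses the batches \<open>w 1, \<dots>, w n\<close>.\<close>
primrec sgm_iter :: "(nat \<Rightarrow> 'h \<Rightarrow> 'q \<Rightarrow> 'h) \<Rightarrow> 'h \<Rightarrow> (nat \<Rightarrow> 'q) \<Rightarrow> nat \<Rightarrow> 'h" where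
  "sgm_iter \<Phi> x1 w 0 = x1"
| "sgm_iter \<Phi> x1 w (Suc n) = \<Phi> (Suc n) (sgm_iter \<Phi> x1 w n) (w (Suc n))"

text \<open>With \<open>y\<close> the shifted iterates, stage \<open>n\<close> is the comparison
  point built from \<open>z\<close> and the first \<open>n\<close> iterates: \<open>y n\<close> is
  iterate number \<open>n + 1\<close>, which matches the weight index \<open>Suc n\<close>.\<close>

primrec running_avg :: "(nat \<Rightarrow> real) \<Rightarrow> 'h::real_vector \<Rightarrow> (nat \<Rightarrow> 'h) \<Rightarrow> nat \<Rightarrow> 'h" where
  "running_avg \<theta> z y 0 = z"
| "running_avg \<theta> z y (Suc n) = (1 - \<theta> (Suc n)) *\<^sub>R y n + \<theta> (Suc n) *\<^sub>R running_avg \<theta> z y n"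

lemma sgm_iter_cong:
  "(\<And>i. i \<in> {1..n} \<Longrightarrow> w i = w' i) \<Longrightarrow> sgm_iter \<Phi> x1 w n = sgm_iter \<Phi> x1 w' n"
proof (induction n)
  case (Suc n)
  have "w (Suc n) = w' (Suc n)" "sgm_iter \<Phi> x1 w n = sgm_iter \<Phi> x1 w' n"
    using Suc.prems by (auto intro!: Suc.IH)
  then show ?case by simp
qed simp

lemma running_avg_cong:
  "(\<And>i. i < n \<Longrightarrow> y i = y' i) \<Longrightarrow> running_avg \<theta> z y n = running_avg \<theta> z y' n"
  by (induction n) auto

text \<open>Steps and levels stay general: the one-step estimates only need positive steps and
  levels of at least \<open>(1 + \<epsilon>) * L\<close>. The reference batch \<open>\<eta>\<close>
  carries the moment bound, which is transferred to the batches of the run through their common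
  law.\<close>

locale clipped_sgm = prob_space M
  for M :: "'w measure" +
  fixes S :: "'s measure" and \<xi> :: "'w \<Rightarrow> 's" and m :: nat
    and uhat :: "'h::{real_inner, banach, second_countable_topology} \<Rightarrow> 's \<Rightarrow> 'h"
    and X :: "'h set" and step level :: "nat \<Rightarrow> real" and x1 :: 'h
    and \<zeta> :: "nat \<Rightarrow> nat \<Rightarrow> 'w \<Rightarrow> 's" and x :: "nat \<Rightarrow> 'w \<Rightarrow> 'h"
    and f :: "'h \<Rightarrow> real" and L \<epsilon> p s :: real and \<eta> :: "nat \<Rightarrow> 'w \<Rightarrow> 's"
  assumes f_convex: "convex_on UNIV f"
    and L_pos: "L > 0" and f_lipschitz: "L-lipschitz_on UNIV f"
    and X: "X \<noteq> {}" "closed X" "convex X"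
    and \<xi>_meas: "\<xi> \<in> measurable M S"
    and uhat_meas: "(\<lambda>(z, s). uhat z s) \<in> borel_measurable (restrict_space borel X \<Otimes>\<^sub>M S)"
    and uhat_integrable: "\<And>z. z \<in> X \<Longrightarrow> integrable M (\<lambda>\<omega>. uhat z (\<xi> \<omega>))"
    and uhat_subgradient:
      "\<And>z. z \<in> X \<Longrightarrow> (\<integral>\<omega>. uhat z (\<xi> \<omega>) \<partial>M) \<in> subdifferential f z"
    and p: "1 < p" "p \<le> 2" and m: "m \<ge> 1" and \<epsilon>: "\<epsilon> > 0"
    and \<eta>_iid: "iid_copies M S \<xi> m \<eta>"
    and batch_moment: "\<And>z. z \<in> X \<Longrightarrow> central_moment_le M p s (batch_mean uhat m \<eta> z)"
    and x1: "x1 \<in> X" and run: "C_SsGM M S \<xi> m uhat X step level x1 \<zeta> x"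
    and step: "\<And>k. k \<ge> 1 \<Longrightarrow> step k > 0"
    and level: "\<And>k. k \<ge> 1 \<Longrightarrow> (1 + \<epsilon>) * L \<le> level k"
begin

section \<open>The update as a measurable function of the past and the batch\<close>

abbreviation "BS \<equiv> PiM {1..m} (\<lambda>_. S)"

definition "batch k \<omega> = (\<lambda>j\<in>{1..m}. \<zeta> k j \<omega>)"

text \<open>The batch \<open>q\<close> itself plays the role of the sample point, with its
  coordinates as samples; this makes the mean a function on the product space.\<close>

definition "bmean = (\<lambda>y q. batch_mean uhat m (\<lambda>j q. q j) y q)"

definition "sgm_step k y q = metric_proj X (y - step k *\<^sub>R clip (bmean y q) (level k))"

abbreviation "iter \<equiv> sgm_iter sgm_step x1"

lemma level_pos: "k \<ge> 1 \<Longrightarrow> level k > 0"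
  using level[of k] L_pos \<epsilon> mult_pos_pos[of "1 + \<epsilon>" L] by linarith

lemma batch_mean_eq: "batch_mean uhat m v y \<omega> = bmean y (\<lambda>j\<in>{1..m}. v j \<omega>)"
  by (auto simp: bmean_def batch_mean_def)

lemma bmean_measurable:
  "(\<lambda>(y, q). bmean y q) \<in> borel_measurable (restrict_space borel X \<Otimes>\<^sub>M BS)"
proof -
  have "(\<lambda>yq. uhat (fst yq) (snd yq j)) \<in> borel_measurable (restrict_space borel X \<Otimes>\<^sub>M BS)"
    if "j \<in> {1..m}" for j
  proof -
    have "(\<lambda>yq. (fst yq, snd yq j)) \<in> measurable (restrict_space borel X \<Otimes>\<^sub>M BS) (restrict_space borel X \<Otimes>\<^sub>M S)"
      using that by (intro measurable_Pair measurable_compose[OF measurable_snd measurable_component_singleton] measurable_fst)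
    from measurable_compose[OF this uhat_meas] show ?thesis by simp
  qed
  then show ?thesis
    unfolding bmean_def batch_mean_def split_beta'
    by (intro borel_measurable_scaleR borel_measurable_const borel_measurable_sum) auto
qed

lemma sgm_step_in: "sgm_step k y q \<in> X"
  unfolding sgm_step_def by (rule metric_proj_closest(1)[OF X])

text \<open>The current point enters through an arbitrary measurable \<open>h\<close> into
  \<open>X\<close>, which covers both iterates as functions of the past and a fixed point.\<close>

lemma sgm_step_measurable:
  assumes "k \<ge> 1" and h: "h \<in> measurable N (restrict_space borel X)"
  shows "(\<lambda>(a, q). sgm_step k (h a) q) \<in> borel_measurable (N \<Otimes>\<^sub>M BS)"
proof -
  have "(\<lambda>z. (h (fst z), snd z)) \<in> measurable (N \<Otimes>\<^sub>M BS) (restrict_space borel X \<Otimes>\<^sub>M BS)"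
    using h by (intro measurable_Pair measurable_compose[OF measurable_fst h] measurable_snd)
  from measurable_compose[OF this bmean_measurable]
  have b: "(\<lambda>z. bmean (h (fst z)) (snd z)) \<in> borel_measurable (N \<Otimes>\<^sub>M BS)" by simp
  have h': "(\<lambda>z. h (fst z)) \<in> borel_measurable (N \<Otimes>\<^sub>M BS)"
    using h by (intro measurable_compose[OF measurable_fst]) (simp add: measurable_restrict_space2_iff)
  have c: "(\<lambda>z. clip (bmean (h (fst z)) (snd z)) (level k)) \<in> borel_measurable (N \<Otimes>\<^sub>M BS)"
    by (rule borel_measurable_continuous_on[OF continuous_on_clip[OF level_pos[OF assms(1)]] b])
  have "(\<lambda>z. h (fst z) - step k *\<^sub>R clip (bmean (h (fst z)) (snd z)) (level k)) \<in> borel_measurable (N \<Otimes>\<^sub>M BS)"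
    using h' c by (intro borel_measurable_diff borel_measurable_scaleR borel_measurable_const)
  from borel_measurable_continuous_on[OF continuous_on_metric_proj[OF X] this]
  show ?thesis by (simp add: sgm_step_def split_beta')
qed

lemma norm_sgm_step_le: "y \<in> X \<Longrightarrow> k \<ge> 1 \<Longrightarrow> norm (sgm_step k y q) \<le> norm y + step k * level k"
proof -
  assume y: "y \<in> X" and k: "k \<ge> 1"
  have "norm (sgm_step k y q - y) \<le> norm (step k *\<^sub>R clip (bmean y q) (level k))"
    using metric_proj_nonexpansive[OF X, of "y - step k *\<^sub>R clip (bmean y q) (level k)" y]
      metric_proj_self[OF X(2,3) y] by (simp add: sgm_step_def dist_norm)
  also have "\<dots> \<le> step k * level k"
    using norm_clip_le[OF level_pos[OF k]] step[OF k] by simp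
  finally show ?thesis
    using norm_triangle_ineq2[of "sgm_step k y q" y] by linarith
qed

lemma iter_in: "iter w n \<in> X"
  using x1 sgm_step_in by (cases n) auto

text \<open>Each clipped step has length at most \<open>step k * level k\<close>, so every iterate
  is bounded by a deterministic constant. All later integrability claims about iterates rest on
  this.\<close>

lemma iter_bounded: "\<exists>c. \<forall>w. norm (iter w n) \<le> c"
proof (induction n)
  case (Suc n)
  then obtain c where c: "\<And>w. norm (iter w n) \<le> c" by blast
  have "norm (iter w (Suc n)) \<le> c + step (Suc n) * level (Suc n)" for w
    using norm_sgm_step_le[OF iter_in[of w n], of "Suc n" "w (Suc n)"] c[of w] by simp
  then show ?case by blast
qed auto

lemma iter_measurable:
  "n < N \<Longrightarrow> (\<lambda>w. iter w n) \<in> measurable (PiM {1..<N} (\<lambda>_. BS)) (restrict_space borel X)"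
proof (induction n)
  case 0
  then show ?case using x1 by (auto simp: measurable_restrict_space2_iff)
next
  case (Suc n)
  have ih: "(\<lambda>w. iter w n) \<in> measurable (PiM {1..<N} (\<lambda>_. BS)) (restrict_space borel X)"
    using Suc by simp
  have w: "(\<lambda>w. w (Suc n)) \<in> measurable (PiM {1..<N} (\<lambda>_. BS)) BS"
    using Suc.prems by (intro measurable_component_singleton) auto
  have "(\<lambda>w. (w, w (Suc n))) \<in> measurable (PiM {1..<N} (\<lambda>_. BS)) (PiM {1..<N} (\<lambda>_. BS) \<Otimes>\<^sub>M BS)"
    using w by (intro measurable_Pair) auto
  from measurable_compose[OF this sgm_step_measurable[OF _ ih, of "Suc n"]]
  have "(\<lambda>w. iter w (Suc n)) \<in> borel_measurable (PiM {1..<N} (\<lambda>_. BS))" by simp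
  then show ?case
    using iter_in[of _ "Suc n"] by (auto simp: measurable_restrict_space2_iff)
qed

text \<open>The run is prescribed only on \<open>space M\<close> and from index 1 on, hence both
  restrictions.\<close>

lemma x_eq_iter: "k \<ge> 1 \<Longrightarrow> \<omega> \<in> space M \<Longrightarrow> x k \<omega> = iter (\<lambda>i. batch i \<omega>) (k - 1)"
proof (induction k rule: nat_induct_at_least)
  case base
  then show ?case using run by (simp add: C_SsGM_def)
next
  case (Suc k)
  have "x (Suc k) \<omega> = sgm_step k (x k \<omega>) (batch k \<omega>)"
    using run Suc.hyps Suc.prems by (simp add: C_SsGM_def sgm_step_def batch_mean_eq batch_def)
  then show ?case using Suc by (cases k) auto
qed

lemma batch_measurable: "k \<ge> 1 \<Longrightarrow> batch k \<in> measurable M BS"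
  using run by (auto simp: C_SsGM_def indep_vars_def batch_def[abs_def])

text \<open>The \<open>k\<close>-th batch is packed as a family over \<open>{k}\<close>, since \<^const>\<open>prob_space.indep_var\<close> requires
  both variables to have the same type.\<close>
lemma past_indep_batch:
  assumes "k \<ge> 1"
  shows "indep_var (PiM {1..<k} (\<lambda>_. BS)) (\<lambda>\<omega>. \<lambda>i\<in>{1..<k}. batch i \<omega>)
    (PiM {k} (\<lambda>_. BS)) (\<lambda>\<omega>. \<lambda>i\<in>{k}. batch i \<omega>)"
proof -
  have ind: "indep_vars (\<lambda>_. BS) batch {1..}"
    using run by (simp add: C_SsGM_def batch_def[abs_def])
  show ?thesis
    using assms by (intro indep_var_restrict[OF ind]) auto
qed

lemma distr_batch: "k \<ge> 1 \<Longrightarrow> distr M BS (batch k) = distr M BS (\<lambda>\<omega>. \<lambda>j\<in>{1..m}. \<eta> j \<omega>)"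
  using distr_iid_copies[OF \<eta>_iid m] distr_iid_copies[of S \<xi> m "\<zeta> k"] run m
  by (simp add: C_SsGM_def batch_def[abs_def])

lemma uhat_section_measurable: "z \<in> X \<Longrightarrow> uhat z \<in> borel_measurable S"
  using measurable_compose[OF measurable_Pair1' uhat_meas, of z] by (simp add: space_restrict_space)

lemma \<eta>_measurable: "j \<in> {1..m} \<Longrightarrow> \<eta> j \<in> measurable M S"
  using \<eta>_iid by (auto simp: iid_copies_def indep_vars_def)

lemma \<eta>_batch_measurable: "(\<lambda>\<omega>. \<lambda>j\<in>{1..m}. \<eta> j \<omega>) \<in> measurable M BS"
  by (intro measurable_restrict \<eta>_measurable)

lemma uhat_\<eta>:
  assumes z: "z \<in> X" and j: "j \<in> {1..m}"
  shows "integrable M (\<lambda>\<omega>. uhat z (\<eta> j \<omega>))"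
    "expectation (\<lambda>\<omega>. uhat z (\<eta> j \<omega>)) = expectation (\<lambda>\<omega>. uhat z (\<xi> \<omega>))"
proof -
  note meas = uhat_section_measurable[OF z] \<eta>_measurable[OF j] \<xi>_meas
  have eq: "distr M S (\<eta> j) = distr M S \<xi>"
    using \<eta>_iid j by (auto simp: iid_copies_def)
  show "integrable M (\<lambda>\<omega>. uhat z (\<eta> j \<omega>))"
    using uhat_integrable[OF z] integrable_distr_eq[OF meas(2,1)] integrable_distr_eq[OF meas(3,1)] eq
    by simp
  show "expectation (\<lambda>\<omega>. uhat z (\<eta> j \<omega>)) = expectation (\<lambda>\<omega>. uhat z (\<xi> \<omega>))"
    using integral_distr[OF meas(2,1)] integral_distr[OF meas(3,1)] eq by simp
qed

lemma batch_mean_\<eta>: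
  assumes z: "z \<in> X"
  shows "integrable M (batch_mean uhat m \<eta> z)"
    "expectation (batch_mean uhat m \<eta> z) \<in> subdifferential f z"
proof -
  show "integrable M (batch_mean uhat m \<eta> z)"
    unfolding batch_mean_def[abs_def]
    by (intro integrable_scaleR_right Bochner_Integration.integrable_sum uhat_\<eta>[OF z])
  have "expectation (batch_mean uhat m \<eta> z) = expectation (\<lambda>\<omega>. uhat z (\<xi> \<omega>))"
    unfolding batch_mean_def[abs_def] integral_scaleR_right
    by (subst Bochner_Integration.integral_sum)
      (use uhat_\<eta>[OF z] m in \<open>auto simp: sum_constant_scaleR\<close>)
  then show "expectation (batch_mean uhat m \<eta> z) \<in> subdifferential f z"
    using uhat_subgradient[OF z] by simp
qed

text \<open>The step given that the current iterate is \<open>y\<close>: the \<open>k\<close>-th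
  batch is exchanged for \<open>\<eta>\<close>, which has the same law, and the deterministic-point
  estimate applies.\<close>

lemma conditional_step:
  assumes k: "k \<ge> 1" and y: "y \<in> X" and z: "z \<in> X"
  shows "expectation (\<lambda>\<omega>. (norm (sgm_step k y (batch k \<omega>) - z))\<^sup>2) \<le>
    (norm (y - z))\<^sup>2 - 2 * step k * (f y - f z)
     + 2 * step k * ((1 + 1/\<epsilon>) powr (p - 1) * s powr p / level k powr (p - 1)) * norm (y - z)
     + (step k)\<^sup>2 * (level k powr (2 - p) * (2 powr (p - 1) * (s powr p + L powr p)))"
proof -
  \<comment> \<open>A one-point space turns the fixed \<open>y\<close> into a measurable map, so the
    joint measurability lemma can be reused.\<close>
  have "(\<lambda>_. y) \<in> measurable (count_space {()}) (restrict_space borel X)"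
    using y by (auto simp: measurable_restrict_space2_iff)
  from measurable_compose[OF measurable_Pair1'[of "()"] sgm_step_measurable[OF k this]]
  have "sgm_step k y \<in> borel_measurable BS" by simp
  then have sq: "(\<lambda>q. (norm (sgm_step k y q - z))\<^sup>2) \<in> borel_measurable BS" by measurable
  have "expectation (\<lambda>\<omega>. (norm (sgm_step k y (batch k \<omega>) - z))\<^sup>2)
     = (\<integral>q. (norm (sgm_step k y q - z))\<^sup>2 \<partial>distr M BS (batch k))"
    by (rule integral_distr[OF batch_measurable[OF k] sq, symmetric])
  also have "\<dots> = expectation (\<lambda>\<omega>. (norm (sgm_step k y (\<lambda>j\<in>{1..m}. \<eta> j \<omega>) - z))\<^sup>2)"
    unfolding distr_batch[OF k] by (rule integral_distr[OF \<eta>_batch_measurable sq])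
  also have "\<dots> = expectation (\<lambda>\<omega>. (norm (metric_proj X
      (y - step k *\<^sub>R clip (batch_mean uhat m \<eta> y \<omega>) (level k)) - z))\<^sup>2)"
    by (simp add: sgm_step_def batch_mean_eq)
  also have "\<dots> \<le> (norm (y - z))\<^sup>2 - 2 * step k * (f y - f z)
     + 2 * step k * ((1 + 1/\<epsilon>) powr (p - 1) * s powr p / level k powr (p - 1)) * norm (y - z)
     + (step k)\<^sup>2 * (level k powr (2 - p) * (2 powr (p - 1) * (s powr p + L powr p)))"
    by (rule clipped_step_expectation[OF f_lipschitz L_pos X z batch_mean_\<eta>[OF y] batch_moment[OF y]
      p \<epsilon> level[OF k] step[OF k]])
  finally show ?thesis .
qed

definition "past k \<omega> = (\<lambda>i\<in>{1..<k}. batch i \<omega>)"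

lemma past_measurable: "past k \<in> measurable M (PiM {1..<k} (\<lambda>_. BS))"
  unfolding past_def[abs_def] by (intro measurable_restrict batch_measurable) auto

text \<open>A version of iterate number \<open>n + 1\<close> given by the recursion at every sample
  point, so that membership in \<open>X\<close> and the bounds hold everywhere and not only on
  \<open>space M\<close>.\<close>

definition "iterate n \<omega> = iter (\<lambda>i. batch i \<omega>) n"

lemma iterate_eq_past: "n < k \<Longrightarrow> iterate n \<omega> = iter (past k \<omega>) n"
  unfolding iterate_def by (rule sgm_iter_cong) (auto simp: past_def)

lemma iterate_rv: "iterate n \<in> borel_measurable M"
proof -
  have "(\<lambda>w. iter w n) \<in> borel_measurable (PiM {1..<Suc n} (\<lambda>_. BS))"
    using iter_measurable[of n "Suc n"] by (simp add: measurable_restrict_space2_iff)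
  moreover have "iterate n = (\<lambda>\<omega>. iter (past (Suc n) \<omega>) n)"
    by (rule ext, rule iterate_eq_past) simp
  ultimately show ?thesis
    using measurable_compose[OF past_measurable] by simp
qed

lemma f_continuous: "continuous_on UNIV f"
  by (rule lipschitz_on_continuous_on[OF f_lipschitz])

lemma bounded_integrable:
  fixes U :: "'w \<Rightarrow> 'h"
  assumes [measurable]: "U \<in> borel_measurable M" and c: "\<And>\<omega>. norm (U \<omega>) \<le> c"
  shows "integrable M (\<lambda>\<omega>. norm (U \<omega>))" "integrable M (\<lambda>\<omega>. (norm (U \<omega>))\<^sup>2)"
    "integrable M (\<lambda>\<omega>. f (U \<omega>))"
proof -
  show "integrable M (\<lambda>\<omega>. norm (U \<omega>))"
    using c by (intro integrable_const_bound[of _ c]) auto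
  show "integrable M (\<lambda>\<omega>. (norm (U \<omega>))\<^sup>2)"
    using c by (intro integrable_const_bound[of _ "c\<^sup>2"]) (auto intro!: power_mono)
  have "norm (f (U \<omega>)) \<le> \<bar>f 0\<bar> + L * c" for \<omega>
  proof -
    have "\<bar>f (U \<omega>) - f 0\<bar> \<le> L * norm (U \<omega>)"
      using lipschitz_onD[OF f_lipschitz, of "U \<omega>" 0] by (simp add: dist_norm)
    also have "\<dots> \<le> L * c" using c L_pos by (intro mult_left_mono) auto
    finally show ?thesis by simp
  qed
  then show "integrable M (\<lambda>\<omega>. f (U \<omega>))"
    by (intro integrable_const_bound[of _ "\<bar>f 0\<bar> + L * c"]
        borel_measurable_continuous_on[OF f_continuous]) auto
qed

lemma iterate_integrable: "integrable M (\<lambda>\<omega>. f (iterate n \<omega>))"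
  using bounded_integrable(3)[OF iterate_rv] iter_bounded[of n] by (auto simp: iterate_def)

section \<open>Comparison points and their one-step inequalities\<close>

context
  fixes \<theta> :: "nat \<Rightarrow> real" and xs :: 'h
  assumes \<theta>: "\<And>k. 0 \<le> \<theta> k" "\<And>k. \<theta> k \<le> 1" and xs: "xs \<in> X"
begin

abbreviation "avg w \<equiv> running_avg \<theta> xs (iter w)"

lemma avg_in: "avg w n \<in> X"
proof (induction n)
  case (Suc n)
  then show ?case
    using convexD[OF X(3) iter_in[of w n] Suc.IH, of "1 - \<theta> (Suc n)" "\<theta> (Suc n)"] \<theta> by simp
qed (use xs in simp)

lemma avg_bounded: "\<exists>c. \<forall>w. norm (avg w n) \<le> c"
proof (induction n)
  case (Suc n)
  then obtain c where c: "\<And>w. norm (avg w n) \<le> c" by blast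
  obtain d where d: "\<And>w. norm (iter w n) \<le> d" using iter_bounded by blast
  have "norm (avg w (Suc n)) \<le> d + c" for w
  proof -
    have "norm (avg w (Suc n)) \<le> (1 - \<theta> (Suc n)) * norm (iter w n) + \<theta> (Suc n) * norm (avg w n)"
      using \<theta>[of "Suc n"] norm_triangle_ineq[of "(1 - \<theta> (Suc n)) *\<^sub>R iter w n" "\<theta> (Suc n) *\<^sub>R avg w n"]
      by simp
    also have "\<dots> \<le> 1 * norm (iter w n) + 1 * norm (avg w n)"
      using \<theta>[of "Suc n"] by (intro add_mono mult_right_mono) auto
    also have "\<dots> \<le> d + c" using c[of w] d[of w] by simp
    finally show ?thesis .
  qed
  then show ?case by blast
qed auto

lemma avg_measurable: "n \<le> N \<Longrightarrow> (\<lambda>w. avg w n) \<in> borel_measurable (PiM {1..<N} (\<lambda>_. BS))"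
proof (induction n)
  case (Suc n)
  have "(\<lambda>w. iter w n) \<in> borel_measurable (PiM {1..<N} (\<lambda>_. BS))"
    using iter_measurable[of n N] Suc.prems by (simp add: measurable_restrict_space2_iff)
  with Suc show ?case by simp
qed simp

definition "average n \<omega> = avg (\<lambda>i. batch i \<omega>) n"

lemma average_eq_past: "n \<le> k \<Longrightarrow> average n \<omega> = avg (past k \<omega>) n"
  unfolding average_def by (intro running_avg_cong sgm_iter_cong) (auto simp: past_def)

lemma average_rv: "average n \<in> borel_measurable M"
proof -
  have "average n = (\<lambda>\<omega>. avg (past n \<omega>) n)"
    by (rule ext, rule average_eq_past) simp
  then show ?thesis
    using measurable_compose[OF past_measurable avg_measurable[of n n]] by simp
qed

lemma average_integrable: "integrable M (\<lambda>\<omega>. f (average n \<omega>))"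
  using bounded_integrable(3)[OF average_rv] avg_bounded[of n] by (auto simp: average_def)

lemma dist_integrable:
  "integrable M (\<lambda>\<omega>. norm (iterate n \<omega> - average n' \<omega>))" "integrable M (\<lambda>\<omega>. (norm (iterate n \<omega> - average n' \<omega>))\<^sup>2)"
proof -
  obtain c d where "\<And>w. norm (iter w n) \<le> c" "\<And>w. norm (avg w n') \<le> d"
    using iter_bounded[of n] avg_bounded[of n'] by blast
  then have b: "norm (iterate n \<omega> - average n' \<omega>) \<le> c + d" for \<omega>
    unfolding iterate_def average_def by (intro order_trans[OF norm_triangle_ineq4 add_mono])
  have "(\<lambda>\<omega>. iterate n \<omega> - average n' \<omega>) \<in> borel_measurable M"
    using iterate_rv average_rv by (intro borel_measurable_diff)
  from bounded_integrable[OF this b]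
  show "integrable M (\<lambda>\<omega>. norm (iterate n \<omega> - average n' \<omega>))" "integrable M (\<lambda>\<omega>. (norm (iterate n \<omega> - average n' \<omega>))\<^sup>2)"
    by auto
qed

text \<open>These three instantiate \<open>F\<close>, \<open>Z\<close> and \<open>e\<close> of the
  last-iterate recursion. The shifts by one restore numbering from 1: \<open>iterate_gap k\<close>
  and \<open>sq_dist k\<close> concern the \<open>k\<close>-th iterate, the latter measured from
  comparison point number \<open>k - 1\<close>.\<close>

definition "iterate_gap k = expectation (\<lambda>\<omega>. f (iterate (k - 1) \<omega>)) - f xs"
definition "average_gap k = expectation (\<lambda>\<omega>. f (average k \<omega>)) - f xs"
definition "sq_dist k = expectation (\<lambda>\<omega>. (norm (iterate (k - 1) \<omega> - average (k - 1) \<omega>))\<^sup>2)"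

lemma sq_dist_nonneg: "0 \<le> sq_dist k"
  unfolding sq_dist_def by (intro Bochner_Integration.integral_nonneg) auto

lemma sq_dist_1: "sq_dist 1 = (norm (x1 - xs))\<^sup>2"
  by (simp add: sq_dist_def iterate_def average_def prob_space)

lemma average_gap_0: "average_gap 0 = 0"
  by (simp add: average_gap_def average_def prob_space)

lemma gap_nonneg:
  assumes min: "\<And>z. z \<in> X \<Longrightarrow> f xs \<le> f z"
  shows "0 \<le> iterate_gap k" "0 \<le> average_gap k"
proof -
  have "f xs \<le> expectation (\<lambda>\<omega>. f (iterate n \<omega>))" for n
    using min iter_in by (intro integral_ge_const iterate_integrable) (auto simp: iterate_def)
  then show "0 \<le> iterate_gap k" by (simp add: iterate_gap_def)
  have "f xs \<le> expectation (\<lambda>\<omega>. f (average n \<omega>))" for n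
    using min avg_in by (intro integral_ge_const average_integrable) (auto simp: average_def)
  then show "0 \<le> average_gap k" by (simp add: average_gap_def)
qed

lemma average_gap_step:
  assumes "k \<ge> 1"
  shows "average_gap k \<le> (1 - \<theta> k) * iterate_gap k + \<theta> k * average_gap (k - 1)"
proof -
  have average: "average k \<omega> = (1 - \<theta> k) *\<^sub>R iterate (k - 1) \<omega> + \<theta> k *\<^sub>R average (k - 1) \<omega>" for \<omega>
    using assms by (cases k) (auto simp: average_def iterate_def)
  have "expectation (\<lambda>\<omega>. f (average k \<omega>)) \<le>
      expectation (\<lambda>\<omega>. (1 - \<theta> k) * f (iterate (k - 1) \<omega>) + \<theta> k * f (average (k - 1) \<omega>))"
  proof (rule integral_mono)
    show "f (average k \<omega>) \<le> (1 - \<theta> k) * f (iterate (k - 1) \<omega>) + \<theta> k * f (average (k - 1) \<omega>)" for \<omega>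
      unfolding average using \<theta> by (intro convex_onD[OF f_convex]) auto
  qed (auto intro!: Bochner_Integration.integrable_add integrable_mult_right iterate_integrable average_integrable)
  also have "\<dots> = (1 - \<theta> k) * expectation (\<lambda>\<omega>. f (iterate (k - 1) \<omega>)) + \<theta> k * expectation (\<lambda>\<omega>. f (average (k - 1) \<omega>))"
    using iterate_integrable average_integrable by simp
  finally show ?thesis
    by (simp add: average_gap_def iterate_gap_def algebra_simps)
qed

text \<open>The step from the \<open>k\<close>-th iterate is measured against comparison point
  number \<open>k\<close>, which already includes that iterate yet depends only on earlier batches,
  so it is independent of the \<open>k\<close>-th batch.\<close>

lemma sq_dist_step:
  assumes k: "k \<ge> 1"
  shows "sq_dist (Suc k) \<le> \<theta> k * sq_dist k - 2 * step k * (iterate_gap k - average_gap k)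
    + 2 * step k * ((1 + 1/\<epsilon>) powr (p - 1) * s powr p / level k powr (p - 1)) * \<theta> k * sqrt (sq_dist k)
    + (step k)\<^sup>2 * (level k powr (2 - p) * (2 powr (p - 1) * (s powr p + L powr p)))"
proof -
  define \<beta> where "\<beta> = 2 * step k * ((1 + 1/\<epsilon>) powr (p - 1) * s powr p / level k powr (p - 1))"
  define G where "G = (step k)\<^sup>2 * (level k powr (2 - p) * (2 powr (p - 1) * (s powr p + L powr p)))"
  have \<beta>: "0 \<le> \<beta>" using step[OF k] by (simp add: \<beta>_def)
  let ?N = "PiM {1..<k} (\<lambda>_. BS)"
  let ?\<phi> = "\<lambda>a b. (norm (sgm_step k (iter a (k - 1)) (b k) - avg a k))\<^sup>2"
  let ?\<psi> = "\<lambda>a. (norm (iter a (k - 1) - avg a k))\<^sup>2 - 2 * step k * (f (iter a (k - 1)) - f (avg a k))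
      + \<beta> * norm (iter a (k - 1) - avg a k) + G"
  let ?Y = "\<lambda>\<omega>. \<lambda>i\<in>{k}. batch i \<omega>"
  have iterate_m: "(\<lambda>w. iter w (k - 1)) \<in> measurable ?N (restrict_space borel X)"
    using iter_measurable[of "k - 1" k] k by simp
  have iterate_m': "(\<lambda>w. iter w (k - 1)) \<in> borel_measurable ?N"
    using iterate_m by (simp add: measurable_restrict_space2_iff)
  have average_m: "(\<lambda>w. avg w k) \<in> borel_measurable ?N"
    by (rule avg_measurable) simp
  obtain c where c: "\<And>w. norm (iter w (k - 1)) \<le> c" using iter_bounded by blast
  obtain d where d: "\<And>w. norm (avg w k) \<le> d" using avg_bounded by blast
  have iterate_past: "iterate (k - 1) \<omega> = iter (past k \<omega>) (k - 1)" for \<omega>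
    using k by (intro iterate_eq_past) auto
  \<comment> \<open>Moving the comparison point towards the current iterate contracts their distance
    by \<open>\<theta> k\<close>; this is the source of both factors \<open>\<theta> k\<close> in
    the claim.\<close>
  have shrink: "norm (iterate (k - 1) \<omega> - average k \<omega>) = \<theta> k * norm (iterate (k - 1) \<omega> - average (k - 1) \<omega>)" for \<omega>
  proof -
    have "iterate (k - 1) \<omega> - average k \<omega> = \<theta> k *\<^sub>R (iterate (k - 1) \<omega> - average (k - 1) \<omega>)"
      using k by (cases k) (auto simp: average_def iterate_def algebra_simps)
    then show ?thesis using \<theta> by simp
  qed
  have "expectation (\<lambda>\<omega>. ?\<phi> (past k \<omega>) (?Y \<omega>)) \<le> expectation (\<lambda>\<omega>. ?\<psi> (past k \<omega>))"
  proof (rule indep_var_expectation_le[where W = "past k" and Y = ?Y and \<phi> = ?\<phi> and \<psi> = ?\<psi>])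
    show "indep_var ?N (past k) (PiM {k} (\<lambda>_. BS)) ?Y"
      using past_indep_batch[OF k] by (simp add: past_def[abs_def])
    have "(\<lambda>z. (fst z, snd z k)) \<in> measurable (?N \<Otimes>\<^sub>M PiM {k} (\<lambda>_. BS)) (?N \<Otimes>\<^sub>M BS)"
      by (intro measurable_Pair measurable_compose[OF measurable_snd measurable_component_singleton] measurable_fst) simp
    from measurable_compose[OF this sgm_step_measurable[OF k iterate_m]]
    have "(\<lambda>z. sgm_step k (iter (fst z) (k - 1)) (snd z k)) \<in> borel_measurable (?N \<Otimes>\<^sub>M PiM {k} (\<lambda>_. BS))"
      by simp
    moreover have "(\<lambda>z. avg (fst z) k) \<in> borel_measurable (?N \<Otimes>\<^sub>M PiM {k} (\<lambda>_. BS))"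
      by (rule measurable_compose[OF measurable_fst average_m])
    ultimately show "(\<lambda>(a, b). ?\<phi> a b) \<in> borel_measurable (?N \<Otimes>\<^sub>M PiM {k} (\<lambda>_. BS))"
      unfolding split_beta' by (intro borel_measurable_power measurable_compose[OF _ borel_measurable_norm] borel_measurable_diff)
    show "\<bar>?\<phi> a b\<bar> \<le> (c + step k * level k + d)\<^sup>2" for a b
    proof -
      have "norm (sgm_step k (iter a (k - 1)) (b k) - avg a k) \<le> c + step k * level k + d"
        using norm_sgm_step_le[OF iter_in k, of a "k - 1" "b k"] c[of a] d[of a]
          norm_triangle_ineq4[of "sgm_step k (iter a (k - 1)) (b k)" "avg a k"] by linarith
      then show ?thesis by (simp add: power_mono)
    qed
    show "expectation (\<lambda>\<omega>. ?\<phi> a (?Y \<omega>)) \<le> ?\<psi> a" for a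
      using conditional_step[OF k iter_in[of a "k - 1"] avg_in[of a k]] by (simp add: \<beta>_def G_def)
    show "?\<psi> \<in> borel_measurable ?N"
      by (intro borel_measurable_add borel_measurable_diff borel_measurable_times borel_measurable_const
          borel_measurable_power measurable_compose[OF _ borel_measurable_norm] iterate_m' average_m
          borel_measurable_continuous_on[OF f_continuous])
    show "integrable M (\<lambda>\<omega>. ?\<psi> (past k \<omega>))"
      using k iterate_integrable[of "k - 1"] average_integrable[of k] dist_integrable[of "k - 1" k]
      by (intro Bochner_Integration.integrable_add Bochner_Integration.integrable_diff integrable_mult_right)
        (simp_all flip: iterate_eq_past average_eq_past)
  qed
  also have "expectation (\<lambda>\<omega>. ?\<phi> (past k \<omega>) (?Y \<omega>)) = sq_dist (Suc k)"
  proof -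
    have "iterate k \<omega> = sgm_step k (iter (past k \<omega>) (k - 1)) (batch k \<omega>)" for \<omega>
      using k iterate_eq_past[of "k - 1" k \<omega>] by (cases k) (auto simp: iterate_def)
    then show ?thesis
      by (simp add: sq_dist_def average_eq_past[of k k])
  qed
  also have "expectation (\<lambda>\<omega>. ?\<psi> (past k \<omega>)) =
      expectation (\<lambda>\<omega>. (norm (iterate (k - 1) \<omega> - average k \<omega>))\<^sup>2 - 2 * step k * (f (iterate (k - 1) \<omega>) - f (average k \<omega>))
        + \<beta> * norm (iterate (k - 1) \<omega> - average k \<omega>) + G)"
    by (simp only: iterate_past average_eq_past[OF order_refl, of k])
  also have "\<dots> = expectation (\<lambda>\<omega>. (norm (iterate (k - 1) \<omega> - average k \<omega>))\<^sup>2)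
      - 2 * step k * (iterate_gap k - average_gap k) + \<beta> * expectation (\<lambda>\<omega>. norm (iterate (k - 1) \<omega> - average k \<omega>)) + G"
    using iterate_integrable[of "k - 1"] average_integrable[of k] dist_integrable[of "k - 1" k]
    by (simp add: iterate_gap_def average_gap_def prob_space)
  also have "\<dots> = (\<theta> k)\<^sup>2 * sq_dist k - 2 * step k * (iterate_gap k - average_gap k)
      + \<beta> * (\<theta> k * expectation (\<lambda>\<omega>. norm (iterate (k - 1) \<omega> - average (k - 1) \<omega>))) + G"
    unfolding shrink sq_dist_def power_mult_distrib by simp
  also have "\<dots> \<le> \<theta> k * sq_dist k - 2 * step k * (iterate_gap k - average_gap k) + \<beta> * (\<theta> k * sqrt (sq_dist k)) + G"
  proof (intro add_mono diff_mono mult_left_mono order_refl)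
    show "(\<theta> k)\<^sup>2 * sq_dist k \<le> \<theta> k * sq_dist k"
      using \<theta>[of k] sq_dist_nonneg[of k] by (intro mult_right_mono) (auto simp: power2_eq_square mult_left_le)
    show "expectation (\<lambda>\<omega>. norm (iterate (k - 1) \<omega> - average (k - 1) \<omega>)) \<le> sqrt (sq_dist k)"
      unfolding sq_dist_def using dist_integrable by (rule expectation_le_sqrt)
  qed (use \<beta> \<theta> less_imp_le[OF step[OF k]] in auto)
  finally show ?thesis
    by (simp add: \<beta>_def G_def mult.assoc)
qed

end

end

subsection \<open>Stepsizes and clipping levels\<close>

text \<open>The exponents \<open>1 / p\<close> of the stepsize and \<open>(p - 1) / p\<close> from
  the level add up to 1.\<close>

lemma step_times_bias_le:
  fixes u l c \<gamma> lam p :: real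
  assumes u: "u \<ge> 1" and p: "1 < p" and lam: "lam > 0" and \<gamma>: "\<gamma> > 0" and c: "c \<ge> 0"
    and l: "lam * u powr (1 / p) \<le> l"
  shows "\<gamma> / u powr (1 / p) * (c / l powr (p - 1)) \<le> \<gamma> * (c / lam powr (p - 1)) / u"
proof -
  have u1: "u powr (1 / p) * u powr ((p - 1) / p) = u"
    using u p by (simp flip: powr_add add_divide_distrib)
  have "0 < lam * u powr (1 / p)"
    using lam u by auto
  then have l0: "0 < l" using l by linarith
  have "lam powr (p - 1) * u powr ((p - 1) / p) = (lam * u powr (1 / p)) powr (p - 1)"
    using lam u by (simp add: powr_mult powr_powr)
  also have "\<dots> \<le> l powr (p - 1)"
    using l lam p by (intro powr_mono2) auto
  finally have "c / l powr (p - 1) \<le> c / (lam powr (p - 1) * u powr ((p - 1) / p))"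
    using c lam u l0 by (intro divide_left_mono mult_pos_pos) auto
  then have "\<gamma> / u powr (1 / p) * (c / l powr (p - 1))
      \<le> \<gamma> / u powr (1 / p) * (c / (lam powr (p - 1) * u powr ((p - 1) / p)))"
    using \<gamma> by (intro mult_left_mono) auto
  also have "\<dots> = \<gamma> * (c / lam powr (p - 1)) / (u powr (1 / p) * u powr ((p - 1) / p))"
    by simp
  finally show ?thesis unfolding u1 .
qed

text \<open>The exponent \<open>2 / p\<close> of the squared stepsize exceeds the exponent
  \<open>(2 - p) / p\<close> from the level by 1. As \<open>u \<ge> 1\<close>, its power can be
  pulled out of the maximum.\<close>

lemma step_sq_times_noise_le:
  fixes u c \<gamma> lam p :: real
  assumes u: "u \<ge> 1" and p: "1 < p" "p \<le> 2" and lam: "lam > 0" and c: "c \<ge> 0"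
  shows "(\<gamma> / u powr (1 / p))\<^sup>2 * (max l (lam * u powr (1 / p)) powr (2 - p) * c)
    \<le> \<gamma>\<^sup>2 * (c * max l lam powr (2 - p)) / u"
proof -
  have u0: "1 \<le> u powr (1 / p)" using u p by (intro ge_one_powr_ge_zero) auto
  have u1: "u powr ((2 - p) / p) / (u powr (1 / p))\<^sup>2 = 1 / u"
  proof -
    have "(u powr (1 / p))\<^sup>2 = u powr (2 / p)"
      using u by (simp add: powr_power)
    then have "u powr ((2 - p) / p) / (u powr (1 / p))\<^sup>2 = u powr ((2 - p) / p - 2 / p)"
      by (simp add: powr_diff)
    also have "(2 - p) / p - 2 / p = - 1" using p by (simp add: field_simps)
    finally show ?thesis using u by (simp add: powr_minus_divide)
  qed
  have "max l (lam * u powr (1 / p)) \<le> max l lam * u powr (1 / p)"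
  proof (rule max.boundedI)
    show "lam * u powr (1 / p) \<le> max l lam * u powr (1 / p)"
      by (intro mult_right_mono) auto
    have "max l lam * 1 \<le> max l lam * u powr (1 / p)"
      using u0 lam by (intro mult_left_mono) auto
    then show "l \<le> max l lam * u powr (1 / p)" by simp
  qed
  then have "max l (lam * u powr (1 / p)) powr (2 - p) \<le> (max l lam * u powr (1 / p)) powr (2 - p)"
    using p lam u0 by (intro powr_mono2) (auto simp: le_max_iff_disj)
  also have "\<dots> = max l lam powr (2 - p) * u powr ((2 - p) / p)"
    using lam u by (simp add: powr_mult powr_powr)
  finally have "(\<gamma> / u powr (1 / p))\<^sup>2 * (max l (lam * u powr (1 / p)) powr (2 - p) * c)
    \<le> (\<gamma> / u powr (1 / p))\<^sup>2 * (max l lam powr (2 - p) * u powr ((2 - p) / p) * c)"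
    using c by (intro mult_left_mono mult_right_mono) auto
  also have "\<dots> = \<gamma>\<^sup>2 * (c * max l lam powr (2 - p)) * (u powr ((2 - p) / p) / (u powr (1 / p))\<^sup>2)"
    by (simp add: power_divide)
  finally show ?thesis unfolding u1 by simp
qed

text \<open>The recursion is run with horizon \<open>T = k\<close>, so the comparison points change
  with \<open>k\<close>. It bounds \<open>k * st k\<close> times the gap, and dividing by
  \<open>k * st k\<close> produces the rate.\<close>

theorem theorem4:
  fixes f :: "'a::{real_inner, banach, second_countable_topology} \<Rightarrow> real"
    and X :: "'a set"
    and M :: "'w measure" and S :: "'s measure"
    and \<xi> :: "'w \<Rightarrow> 's" and uhat :: "'a \<Rightarrow> 's \<Rightarrow> 'a"
    and \<eta> :: "nat \<Rightarrow> 'w \<Rightarrow> 's" and \<zeta> :: "nat \<Rightarrow> nat \<Rightarrow> 'w \<Rightarrow> 's"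
    and x :: "nat \<Rightarrow> 'w \<Rightarrow> 'a" and x1 xs :: 'a
    and L p \<sigma> \<sigma>m \<epsilon> \<gamma> lam ap bp Le vp wp :: real and m k :: nat
  assumes f_convex: "convex_on UNIV f"
    and L_pos: "L > 0" and f_lipschitz: "L-lipschitz_on UNIV f"
    and X: "X \<noteq> {}" "closed X" "convex X"
    and prob: "prob_space M" and \<xi>_meas: "\<xi> \<in> measurable M S"
    and uhat_meas: "(\<lambda>(z, s). uhat z s) \<in> borel_measurable (restrict_space borel X \<Otimes>\<^sub>M S)"
    and uhat_integrable: "\<And>z. z \<in> X \<Longrightarrow> integrable M (\<lambda>\<omega>. uhat z (\<xi> \<omega>))"
    and uhat_subgradient:
      "\<And>z. z \<in> X \<Longrightarrow> (\<integral>\<omega>. uhat z (\<xi> \<omega>) \<partial>M) \<in> subdifferential f z"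
    and p: "1 < p" "p \<le> 2" and \<sigma>_nonneg: "\<sigma> \<ge> 0"
    and uhat_moment: "\<And>z. z \<in> X \<Longrightarrow> central_moment_le M p \<sigma> (\<lambda>\<omega>. uhat z (\<xi> \<omega>))"
    and m: "m \<ge> 1" and \<epsilon>: "\<epsilon> > 0" and \<sigma>m_nonneg: "\<sigma>m \<ge> 0"
    and \<eta>_iid: "iid_copies M S \<xi> m \<eta>"
    and batch_moment: "\<And>z. z \<in> X \<Longrightarrow> central_moment_le M p \<sigma>m (batch_mean uhat m \<eta> z)"
    and ap: "ap = (1 + 1 / \<epsilon>) powr (p - 1) * \<sigma>m powr p"
    and bp: "bp = 2 powr (p - 1) * (\<sigma>m powr p + L powr p)"
    and Le: "Le = (1 + \<epsilon>) * L"
    and \<gamma>: "\<gamma> > 0" and lam: "lam > 0"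
    and x1: "x1 \<in> X"
    and run: "C_SsGM M S \<xi> m uhat X
        (\<lambda>k. \<gamma> / (real k * (1 + ln (real k))) powr (1 / p))
        (\<lambda>k. max Le (lam * (real k * (1 + ln (real k))) powr (1 / p)))
        x1 \<zeta> x"
    and xs: "is_arg_min f (\<lambda>z. z \<in> X) xs"
    and vp: "vp = 4 * ap / lam powr (p - 1)"
    and wp: "wp = bp * (max Le lam) powr (2 - p)"
    and k: "k \<ge> 1"
  shows "integrable M (\<lambda>\<omega>. f (x k \<omega>)) \<and>
    (\<integral>\<omega>. f (x k \<omega>) \<partial>M) - (INF z\<in>X. f z) \<le>
      (1 + ln (real k)) powr (1 / p) / real k powr ((p - 1) / p) *
      (5 / 9 * ((norm (x1 - xs))\<^sup>2 / \<gamma>) + 6 / 5 * vp * norm (x1 - xs)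
        + 3 / 4 * \<gamma> * (1 + ln (1 + ln (real k)))\<^sup>2 * (vp + sqrt wp)\<^sup>2)"
proof -
  define st where "st k = \<gamma> / (real k * (1 + ln (real k))) powr (1 / p)" for k
  define lv where "lv k = max Le (lam * (real k * (1 + ln (real k))) powr (1 / p))" for k
  interpret clipped_sgm M S \<xi> m uhat X st lv x1 \<zeta> x f L \<epsilon> p \<sigma>m \<eta>
  proof (intro clipped_sgm.intro clipped_sgm_axioms.intro)
    show "C_SsGM M S \<xi> m uhat X st lv x1 \<zeta> x"
      using run by (simp add: st_def[abs_def] lv_def[abs_def])
    show "0 < st k" if "k \<ge> 1" for k
      unfolding st_def using \<gamma> one_le_times_one_plus_ln[OF that] by (intro divide_pos_pos powr_gt_zero[THEN iffD2]) linarith+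
    show "(1 + \<epsilon>) * L \<le> lv k" if "k \<ge> 1" for k
      by (simp add: lv_def Le)
  qed (fact assms)+
  \<comment> \<open>Bounds on the tail ratios are available on \<open>{1..k}\<close> only; the
    default 1 keeps every weight in the unit interval.\<close>
  define \<theta> where "\<theta> j = (if j \<in> {1..k} then tail_ratio st k j else 1)" for j
  define u where "u j = real j * (1 + ln (real j))" for j
  define s where "s j = 1 / u j" for j
  define Sg where "Sg = 1 + ln (1 + ln (real k))"
  define D where "D = norm (x1 - xs)"
  define R where "R = 5/9 * D\<^sup>2 + 6/5 * (\<gamma> * vp * D) + 3/4 * \<gamma>\<^sup>2 * Sg\<^sup>2 * (vp + sqrt wp)\<^sup>2"
  have xs_in: "xs \<in> X" and min: "f xs \<le> f z" if "z \<in> X" for z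
    using xs that by (auto simp: is_arg_min_def not_less)
  have xsX: "xs \<in> X" using xs_in X(1) by blast
  have ap0: "0 \<le> ap" and bp0: "0 \<le> bp"
    by (auto simp: ap bp)
  have vp0: "0 \<le> vp" and wp0: "0 \<le> wp"
    using ap0 bp0 by (auto simp: vp wp)
  have u1: "1 \<le> u j" if "j \<ge> 1" for j
    using one_le_times_one_plus_ln[OF that] by (simp add: u_def)
  have u_mono: "u i \<le> u j" if "1 \<le> i" "i \<le> j" for i j
    unfolding u_def using that by (intro mult_mono) auto
  have st_mono: "\<forall>j\<in>{1..k}. st k \<le> st j"
  proof
    fix j assume j: "j \<in> {1..k}"
    have "u j powr (1 / p) \<le> u k powr (1 / p)"
      using u_mono[of j k] u1[of j] j p by (intro powr_mono2) auto
    then show "st k \<le> st j"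
      unfolding st_def u_def[symmetric] using \<gamma> u1[of j] u1[of k] j k
      by (intro divide_left_mono mult_pos_pos) auto
  qed
  have st_pos: "0 < st k" using k by (rule step)
  have \<theta>01: "0 \<le> \<theta> j" "\<theta> j \<le> 1" for j
    using tail_weights(2)[OF k st_mono st_pos, of j] by (auto simp: \<theta>_def)
  have \<theta>_eq: "\<theta> j = tail_ratio st k j" if "j \<in> {1..k}" for j
    using that by (simp add: \<theta>_def)
  \<comment> \<open>\<open>vp\<close> contains the factor 4 whereas the recursion produces 2, hence
    \<open>vp / 2\<close>.\<close>
  have bias: "2 * st j * ((1 + 1/\<epsilon>) powr (p - 1) * \<sigma>m powr p / lv j powr (p - 1)) \<le> \<gamma> * vp / 2 * s j"
    if "j \<in> {1..k}" for j
  proof -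
    have "st j * (ap / lv j powr (p - 1)) \<le> \<gamma> * (ap / lam powr (p - 1)) / u j"
      using step_times_bias_le[OF u1[of j] p(1) lam \<gamma> ap0, of "lv j"] that
      by (simp add: st_def lv_def u_def)
    moreover have "\<gamma> * vp / 2 * s j = 2 * (\<gamma> * (ap / lam powr (p - 1)) / u j)"
      by (simp add: vp s_def)
    ultimately show ?thesis
      unfolding ap[symmetric] by linarith
  qed
  have noise: "(st j)\<^sup>2 * (lv j powr (2 - p) * (2 powr (p - 1) * (\<sigma>m powr p + L powr p)))
      \<le> \<gamma>\<^sup>2 * (sqrt wp)\<^sup>2 * s j" if "j \<in> {1..k}" for j
    using step_sq_times_noise_le[OF u1[of j] p lam bp0, of \<gamma> Le] that wp0
    by (simp add: st_def lv_def u_def s_def flip: bp wp)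
  have "real k * st k * iterate_gap xs k \<le> R"
    unfolding R_def
  proof (rule last_iterate_bound[where g = st and T = k and F = "iterate_gap xs" and Z = "average_gap \<theta> xs" and e = "sq_dist \<theta> xs" and s = s
      and b = "\<lambda>j. 2 * st j * ((1 + 1/\<epsilon>) powr (p - 1) * \<sigma>m powr p / lv j powr (p - 1))"
      and h = "\<lambda>j. (st j)\<^sup>2 * (lv j powr (2 - p) * (2 powr (p - 1) * (\<sigma>m powr p + L powr p)))"
      and B = "\<Sum>j=1..k. s j * (real k / real (max (k - j) 1))"])
    show "\<forall>j\<in>{1..k}. st k \<le> st j" by (rule st_mono)
    show "0 \<le> iterate_gap xs j" "0 \<le> average_gap \<theta> xs j" for j
      using gap_nonneg[where \<theta> = \<theta>, OF \<theta>01 xsX min] by auto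
    show "average_gap \<theta> xs 0 = 0" by (rule average_gap_0[where \<theta> = \<theta>, OF \<theta>01 xsX])
    show "0 \<le> sq_dist \<theta> xs j" for j by (rule sq_dist_nonneg[where \<theta> = \<theta>, OF \<theta>01 xsX])
    show "sq_dist \<theta> xs 1 = D\<^sup>2" unfolding D_def by (rule sq_dist_1[where \<theta> = \<theta>, OF \<theta>01 xsX])
    show "\<forall>j\<in>{1..k}. sq_dist \<theta> xs (Suc j) \<le> tail_ratio st k j * sq_dist \<theta> xs j - 2 * st j * (iterate_gap xs j - average_gap \<theta> xs j)
        + 2 * st j * ((1 + 1/\<epsilon>) powr (p - 1) * \<sigma>m powr p / lv j powr (p - 1)) * tail_ratio st k j * sqrt (sq_dist \<theta> xs j)
        + (st j)\<^sup>2 * (lv j powr (2 - p) * (2 powr (p - 1) * (\<sigma>m powr p + L powr p)))"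
      (is "\<forall>j\<in>_. ?P j")
    proof
      fix j assume "j \<in> {1..k}"
      then show "?P j"
        using sq_dist_step[where \<theta> = \<theta>, OF \<theta>01 xsX, of j] \<theta>_eq[of j] by simp
    qed
    show "\<forall>j\<in>{1..k}. average_gap \<theta> xs j \<le> (1 - tail_ratio st k j) * iterate_gap xs j + tail_ratio st k j * average_gap \<theta> xs (j - 1)"
      using average_gap_step[where \<theta> = \<theta>, OF \<theta>01 xsX] \<theta>_eq by force
    show "0 \<le> s j" if "j \<in> {1..k}" for j
      using u1[of j] that by (simp add: s_def)
    show "0 \<le> 2 * st j * ((1 + 1/\<epsilon>) powr (p - 1) * \<sigma>m powr p / lv j powr (p - 1)) \<and>
        2 * st j * ((1 + 1/\<epsilon>) powr (p - 1) * \<sigma>m powr p / lv j powr (p - 1)) \<le> \<gamma> * vp / 2 * s j"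
      if "j \<in> {1..k}" for j
      using bias[OF that] step[of j] that by simp
    show "0 \<le> (st j)\<^sup>2 * (lv j powr (2 - p) * (2 powr (p - 1) * (\<sigma>m powr p + L powr p))) \<and>
        (st j)\<^sup>2 * (lv j powr (2 - p) * (2 powr (p - 1) * (\<sigma>m powr p + L powr p))) \<le> \<gamma>\<^sup>2 * (sqrt wp)\<^sup>2 * s j"
      if "j \<in> {1..k}" for j
      using noise[OF that] by simp
    show "1 \<le> Sg" using k by (simp add: Sg_def)
    show "(\<Sum>j=1..k. s j) \<le> Sg"
      using sum_inverse_n_ln_le[OF k] by (simp add: s_def u_def Sg_def)
    show "(\<Sum>j=1..k. s j * (real k / real (max (k - j) 1))) \<le> Sg + 5/2"
      "(\<Sum>j=1..k. s j * (real k / real (max (k - j) 1))) \<le> 3/2 * Sg\<^sup>2"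
      using weighted_sum_le[OF k] by (simp_all add: s_def u_def Sg_def)
  qed (use k st_pos \<gamma> vp0 wp0 in \<open>auto simp: D_def\<close>)
  then have gap: "iterate_gap xs k \<le> R / (real k * st k)"
    using k st_pos by (simp add: field_simps)
  have "iterate (k - 1) \<omega> = x k \<omega>" if "\<omega> \<in> space M" for \<omega>
    using x_eq_iter[OF k that] by (simp add: iterate_def)
  then have "integrable M (\<lambda>\<omega>. f (x k \<omega>))"
    and E_eq: "(\<integral>\<omega>. f (x k \<omega>) \<partial>M) - f xs = iterate_gap xs k"
    using iterate_integrable[of "k - 1"]
    by (simp_all add: iterate_gap_def[where \<theta> = \<theta>, OF \<theta>01 xsX] cong: Bochner_Integration.integrable_cong Bochner_Integration.integral_cong)
  moreover have "(INF z\<in>X. f z) = f xs"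
    using xsX min by (intro cInf_eq_minimum) auto
  \<comment> \<open>One factor \<open>k\<close> combines with the \<open>1 / p\<close> power in the
    stepsize to leave \<open>k powr ((p - 1) / p)\<close>.\<close>
  moreover have "R / (real k * st k) = (1 + ln (real k)) powr (1 / p) / real k powr ((p - 1) / p) * (R / \<gamma>)"
  proof -
    have "real k powr (1 / p) * real k powr ((p - 1) / p) = real k"
      using k p by (simp flip: powr_add add_divide_distrib)
    then have k_eq: "real k powr (1 / p) = real k / real k powr ((p - 1) / p)"
      using k by (simp add: field_simps)
    have "(real k * (1 + ln (real k))) powr (1 / p) = real k powr (1 / p) * (1 + ln (real k)) powr (1 / p)"
      by (rule powr_mult)
    then show ?thesis
      using k \<gamma> by (simp add: st_def k_eq mult.commute)
  qed
  moreover have "R / \<gamma> = 5 / 9 * ((norm (x1 - xs))\<^sup>2 / \<gamma>) + 6 / 5 * vp * norm (x1 - xs)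
        + 3 / 4 * \<gamma> * (1 + ln (1 + ln (real k)))\<^sup>2 * (vp + sqrt wp)\<^sup>2"
    using \<gamma> by (simp add: R_def D_def Sg_def field_simps power2_eq_square)
  ultimately show ?thesis
    using gap by simp
qed

end
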